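(* Let $t_0<\theta$, $x_0\in\mathbb{R}^n$, $p>1$, $r>0$, and let $f:[t_0,\theta]\times\mathbb{R}^n\times\mathbb{R}^m\to\mathbb{R}^n$ satisfy Assumptions (A), (B), (C) of the context. Then for every $\varepsilon>0$ there exist $\beta_*=\beta_*(\varepsilon)>0$, $\Delta_*=\Delta_*(\varepsilon)>0$, $\delta_*=\delta_*(\varepsilon)>0$ and $\sigma_*=\sigma_*(\varepsilon,\beta_*(\varepsilon))>0$ such that for every uniform partition $\Gamma$ of $[t_0,\theta]$ with diameter $\Delta\in(0,\Delta_*]$, every uniform partition $\Lambda$ of $[0,\beta_*]$ with diameter $\delta\in(0,\delta_*]$, every $\sigma\in(0,\sigma_*]$ and every finite $\sigma$-net $S_\sigma$ on the unit sphere $S$ of $\mathbb{R}^m$, the inequality $$h_C\left(X_{p,r}(t_0,x_0),\,X_{p,r}^{\beta_*,\Delta,\delta,\sigma}(t_0,x_0)\right)\le\frac{\varepsilon}{2}$$ holds.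
   Context: Control system: $\dot x(t)=f(t,x(t),u(t))$, $x(t_0)=x_0$, $t\in[t_0,\theta]$, with $x(t)\in\mathbb{R}^n$, $u(t)\in\mathbb{R}^m$. $\|\cdot\|$ is the Euclidean norm. Assumptions on $f$: (A) $f$ is continuous. (B) For every bounded set $D\subset[t_0,\theta]\times\mathbb{R}^n$ there exist $\gamma_1=\gamma_1(D)>0$, $\gamma_2=\gamma_2(D)>0$, $\gamma_3=\gamma_3(D)>0$ such that $\|f(t,x_1,u_1)-f(t,x_2,u_2)\|\le[\gamma_1+\gamma_2(\|u_1\|+\|u_2\|)]\|x_1-x_2\|+\gamma_3\|u_1-u_2\|$ for all $(t,x_1,u_1),(t,x_2,u_2)\in D\times\mathbb{R}^m$. (C) There exists $c>0$ such that $\|f(t,x,u)\|\le c(\|x\|+1)(\|u\|+1)$ for all $(t,x,u)\in[t_0,\theta]\times\mathbb{R}^n\times\mathbb{R}^m$. Admissible controls: $U_{p,r}=\{u(\cdot)\in L_p([t_0,\theta];\mathbb{R}^m):\|u(\cdot)\|_p\le r\}$, where $\|u(\cdot)\|_p=\left(\int_{t_0}^\theta\|u(s)\|^p\,ds\right)^{1/p}$. The trajectory generated by $u(\cdot)\in U_{p,r}$ is the (unique) absolutely continuous $x(\cdot):[t_0,\theta]\to\mathbb{R}^n$ with $\dot x(t)=f(t,x(t),u(t))$ for almost all $t\in[t_0,\theta]$ and $x(t_0)=x_0$. $X_{p,r}(t_0,x_0)$ is the set of trajectories generated by all $u(\cdot)\in U_{p,r}$. Discretization: let $\beta>0$, $\sigma>0$;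 $\Gamma=\{t_0,t_1,\dots,t_N=\theta\}$ is a uniform partition of $[t_0,\theta]$ with diameter $\Delta=t_{i+1}-t_i$ $(i=0,\dots,N-1)$; $\Lambda=\{0=r_0,r_1,\dots,r_q=\beta\}$ is a uniform partition of $[0,\beta]$ with diameter $\delta=r_{j+1}-r_j$ $(j=0,\dots,q-1)$; $S=\{x\in\mathbb{R}^m:\|x\|=1\}$; $S_\sigma=\{b_1,\dots,b_a\}\subset S$ is a finite $\sigma$-net on $S$ (every point of $S$ is within distance $\sigma$ of some $b_l$). Then $U_{p,r}^{\beta,\Delta,\delta,\sigma}$ is the (finite) set of functions $u(\cdot)\in L_p([t_0,\theta];\mathbb{R}^m)$ such that $u(t)=r_{j_i}b_{l_i}$ for $t\in[t_i,t_{i+1})$, with $r_{j_i}\in\Lambda$, $b_{l_i}\in S_\sigma$, $i=0,\dots,N-1$, and $\Delta\sum_{i=0}^{N-1}r_{j_i}^p\le r^p$. $X_{p,r}^{\beta,\Delta,\delta,\sigma}(t_0,x_0)$ is the set of trajectories generated by all $u(\cdot)\in U_{p,r}^{\beta,\Delta,\delta,\sigma}$. $h_C(\cdot,\cdot)$ is the Hausdorff distance between (bounded, not necessarily closed) subsets of $C([t_0,\theta];\mathbb{R}^n)$ with norm $\|x(\cdot)\|_C=\max_{t\in[t_0,\theta]}\|x(t)\|$: $h_C(A,B)=\max\{\sup_{a\in A}\inf_{b\in B}\|a-b\|_C,\ \sup_{b\in B}\inf_{a\in A}\|a-b\|_C\}$. *)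

theory Defs
  imports "HOL-Analysis.Analysis"
begin

definition abs_continuous_on_interval :: "real \<Rightarrow> real \<Rightarrow> (real \<Rightarrow> 'a::metric_space) \<Rightarrow> bool" where
  "abs_continuous_on_interval a b x \<longleftrightarrow>
     (\<forall>\<epsilon>>0. \<exists>\<delta>>0. \<forall>(k::nat) l r.
        (\<forall>i<k. a \<le> l i \<and> l i \<le> r i \<and> r i \<le> b) \<and>
        disjoint_family_on (\<lambda>i. {l i<..<r i}) {..<k} \<and>
        (\<Sum>i<k. r i - l i) < \<delta> \<longrightarrow>
        (\<Sum>i<k. dist (x (r i)) (x (l i))) < \<epsilon>)"

text \<open>The elements of \<open>L\<^sub>p\<close> are represented by functions, not by classes modulo null sets.\<close>

definition Lp_space :: "real \<Rightarrow> real \<Rightarrow> real \<Rightarrow> (real \<Rightarrow> 'a::euclidean_space) set" where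
  "Lp_space p a b =
     {u \<in> borel_measurable (lebesgue_on {a..b}).
        integrable (lebesgue_on {a..b}) (\<lambda>s. norm (u s) powr p)}"

definition Lp_norm :: "real \<Rightarrow> real \<Rightarrow> real \<Rightarrow> (real \<Rightarrow> 'a::euclidean_space) \<Rightarrow> real" where
  "Lp_norm p a b u = (LINT s|lebesgue_on {a..b}. norm (u s) powr p) powr (1 / p)"

definition Lp_ball :: "real \<Rightarrow> real \<Rightarrow> real \<Rightarrow> real \<Rightarrow> (real \<Rightarrow> 'a::euclidean_space) set" where
  "Lp_ball p r a b = {u \<in> Lp_space p a b. Lp_norm p a b u \<le> r}"

definition uniform_partition :: "real \<Rightarrow> real \<Rightarrow> real \<Rightarrow> nat \<Rightarrow> (nat \<Rightarrow> real) \<Rightarrow> bool" where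
  "uniform_partition a b d N \<tau> \<longleftrightarrow>
     \<tau> 0 = a \<and> \<tau> N = b \<and> (\<forall>i<N. \<tau> (Suc i) - \<tau> i = d)"

definition sphere_net :: "real \<Rightarrow> 'a::euclidean_space set \<Rightarrow> bool" where
  "sphere_net \<sigma> B \<longleftrightarrow>
     finite B \<and> B \<subseteq> sphere 0 1 \<and> (\<forall>s\<in>sphere 0 1. \<exists>b\<in>B. dist s b \<le> \<sigma>)"

text \<open>
  The time grid is \<open>\<tau> 0, \<dots>, \<tau> N\<close> with step \<open>\<Delta>\<close>, the grid of radii is \<open>\<rho> 0, \<dots>, \<rho> q\<close>, and \<open>B\<close> is
  the net on the sphere.  The value of a control at the final time \<open>b\<close> is left free.
\<close>

definition step_controls ::
  "real \<Rightarrow> real \<Rightarrow> real \<Rightarrow> real \<Rightarrow> real \<Rightarrow> nat \<Rightarrow> (nat \<Rightarrow> real) \<Rightarrow> nat \<Rightarrow> (nat \<Rightarrow> real) \<Rightarrow>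
   'a::euclidean_space set \<Rightarrow> (real \<Rightarrow> 'a) set" where
  "step_controls p r a b \<Delta> N \<tau> q \<rho> B =
     {u \<in> Lp_space p a b.
        \<exists>j v. (\<forall>i<N. j i \<le> q \<and> v i \<in> B \<and> (\<forall>t\<in>{\<tau> i..<\<tau> (Suc i)}. u t = \<rho> (j i) *\<^sub>R v i)) \<and>
              \<Delta> * (\<Sum>i<N. \<rho> (j i) powr p) \<le> r powr p}"

text \<open>
  Trajectories on \<open>[a, b]\<close> are extensional, so that they are elements of the library's space
  \<^const>\<open>cfunspace\<close> of continuous functions (whose distance is set to 0 outside that space).
\<close>

definition trajectory ::
  "(real \<Rightarrow> 'x::euclidean_space \<Rightarrow> 'u::euclidean_space \<Rightarrow> 'x) \<Rightarrow> real \<Rightarrow> real \<Rightarrow> 'x \<Rightarrow>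
   (real \<Rightarrow> 'u) \<Rightarrow> (real \<Rightarrow> 'x) \<Rightarrow> bool" where
  "trajectory f a b x0 u x \<longleftrightarrow>
     x \<in> extensional {a..b} \<and> abs_continuous_on_interval a b x \<and> x a = x0 \<and>
     (AE t in lebesgue_on {a..b}.
        (x has_vector_derivative f t (x t) (u t)) (at t within {a..b}))"

definition trajectories ::
  "(real \<Rightarrow> 'x::euclidean_space \<Rightarrow> 'u::euclidean_space \<Rightarrow> 'x) \<Rightarrow> real \<Rightarrow> real \<Rightarrow> 'x \<Rightarrow>
   (real \<Rightarrow> 'u) set \<Rightarrow> (real \<Rightarrow> 'x) set" where
  "trajectories f a b x0 U = {x. \<exists>u\<in>U. trajectory f a b x0 u x}"

abbreviation C_space :: "real \<Rightarrow> real \<Rightarrow> (real \<Rightarrow> 'x::euclidean_space) metric" where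
  "C_space a b \<equiv> cfunspace (top_of_set {a..b}) euclidean_metric"

text \<open>
  The Hausdorff distance takes values in \<^typ>\<open>ennreal\<close>, so that no boundedness is needed for the
  suprema to be meaningful; for nonempty bounded sets it is the usual real number.
\<close>

definition hausdorff_mdist :: "'a metric \<Rightarrow> 'a set \<Rightarrow> 'a set \<Rightarrow> ennreal" where
  "hausdorff_mdist m A B =
     max (SUP a\<in>A. INF b\<in>B. ennreal (mdist m a b))
         (SUP b\<in>B. INF a\<in>A. ennreal (mdist m a b))"

lemma abs_continuous_on_interval_imp_continuous_on:
  assumes "abs_continuous_on_interval a b x"
  shows "continuous_on {a..b} x"
  unfolding continuous_on_iff
proof (intro ballI allI impI)
  fix s e :: real
  assume s: "s \<in> {a..b}" and e: "0 < e"
  from assms e obtain d where d: "d > 0"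
    and *: "\<And>(k::nat) l r. (\<forall>i<k. a \<le> l i \<and> l i \<le> r i \<and> r i \<le> b) \<and>
        disjoint_family_on (\<lambda>i. {l i<..<r i}) {..<k} \<and> (\<Sum>i<k. r i - l i) < d \<Longrightarrow>
        (\<Sum>i<k. dist (x (r i)) (x (l i))) < e"
    unfolding abs_continuous_on_interval_def by meson
  have "dist (x t) (x s) < e" if t: "t \<in> {a..b}" "dist t s < d" for t
  proof (cases "s \<le> t")
    case True
    then show ?thesis
      using *[of 1 "\<lambda>_. s" "\<lambda>_. t"] s t by (auto simp: disjoint_family_on_def dist_real_def)
  next
    case False
    then show ?thesis
      using *[of 1 "\<lambda>_. t" "\<lambda>_. s"] s t
      by (auto simp: disjoint_family_on_def dist_real_def dist_commute)
  qed
  with d show "\<exists>d>0. \<forall>t\<in>{a..b}. dist t s < d \<longrightarrow> dist (x t) (x s) < e" by blast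
qed

lemma trajectory_in_C_space:
  assumes "trajectory f a b x0 u x"
  shows "x \<in> mspace (C_space a b)"
proof -
  have c: "continuous_on {a..b} x" and e: "x \<in> extensional {a..b}"
    using assms abs_continuous_on_interval_imp_continuous_on by (auto simp: trajectory_def)
  then have "bounded (x ` {a..b})"
    using compact_continuous_image compact_imp_bounded by blast
  with c e show ?thesis
    by (simp add: Met_TC.fspace_def)
qed

lemma mdist_C_space:
  assumes "x \<in> mspace (C_space a b)" "y \<in> mspace (C_space a b)" "a \<le> b"
  shows "mdist (C_space a b) x y = (SUP t\<in>{a..b}. norm (x t - y t))"
  using assms by (auto simp: mdist_cfunspace_eq_mdist_funspace Met_TC.fdist_def Met_TC.fspace_def dist_norm)

end

theory Submission
  imports Defs
begin

text \<open>
  Averaging a control over the cells of a fine partition changes it little in \<open>L\<^sub>1\<close> and, by Jensen's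
  inequality, does not increase its \<open>L\<^sub>p\<close> norm; rounding the radii of the averages down to the grid
  and their directions to the net keeps the norm constraint.  By Gronwall's inequality, controls
  that are close in \<open>L\<^sub>1\<close> generate uniformly close trajectories.  The admissible step size depends
  on the control, but since \<open>norm u \<le> K + norm u powr p / K powr (p - 1)\<close> for every \<open>K > 0\<close>, the
  trajectories are uniformly bounded and equicontinuous, so that it has to be chosen only for the
  finitely many controls that generate an \<open>\<epsilon> / 4\<close>-net of trajectories.  Conversely, step controls are
  admissible.  Existence of trajectories is needed for step controls only, where it follows from
  Picard iteration.
\<close>

section \<open>Absolutely continuous functions\<close>

text \<open>Apart from the time step, every constant is uniform over the ball of controls: a common
  bound on the trajectories lets assumption (B) be used on one single cylinder, and the Gronwall
  kernel \<open>\<gamma>1 + \<gamma>2 * (norm u + norm v)\<close> has an integral bounded in terms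
  of \<open>r\<close>. Averaging is the obstacle: controls of a fixed size that oscillate ever
  faster defeat every fixed step, and the ball is not precompact in L1. Compactness is therefore
  sought among the trajectories, where total boundedness is enough; the net must consist of
  trajectories, so that each element carries a control to average. No limit of controls is formed,
  which nonlinearity in the control would obstruct. The strict inequality \<open>p > 1\<close> makes
  the tail \<open>r powr p / K powr (p - 1)\<close> vanish as \<open>K\<close> grows. This gives
  equicontinuity with \<open>K\<close> as an auxiliary level and bounds the loss from capping radii
  with \<open>K = \<beta>\<close>. Hence \<open>\<beta>\<close> depends on \<open>\<epsilon>\<close>
  alone, and the mesh of the net is chosen after it because the directional error is
  \<open>\<beta> * \<sigma>\<close>.\<close>

lemma abs_continuous_fundamental_theorem:
  fixes F :: "real \<Rightarrow> 'a::euclidean_space"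
  assumes ac: "abs_continuous_on_interval a b F" and "a \<le> b" and Z: "negligible Z"
    and der: "\<And>t. t \<in> {a..b} - Z \<Longrightarrow> (F has_vector_derivative g t) (at t within {a..b})"
  shows "(g has_integral F b - F a) {a..b}"
proof -
  \<comment> \<open>With the value 0 on \<open>Z\<close>, cells tagged there add nothing to the
    Riemann sum, and only the increments of \<open>F\<close> over them have to be small.\<close>
  define h where "h t = (if t \<in> Z then 0 else g t)" for t
  have "(h has_integral F b - F a) {a..b}"
    unfolding has_integral_real
  proof (intro allI impI)
    fix e :: real assume "e > 0"
    \<comment> \<open>Off \<open>Z\<close> the gauge comes from the derivative; on \<open>Z\<close> it stays inside an open set of measure less
      than \<open>d'\<close>, so that absolute continuity bounds the increments of \<open>F\<close> over the cells tagged in \<open>Z\<close>.\<close>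
    define e1 where "e1 = e / (2 * (b - a + 1))"
    have e1: "e1 > 0" using \<open>e > 0\<close> \<open>a \<le> b\<close> by (simp add: e1_def)
    have "\<exists>d>0. t \<in> {a..b} - Z \<longrightarrow> (\<forall>y\<in>{a..b}. norm (y - t) < d \<longrightarrow>
            norm (F y - F t - (y - t) *\<^sub>R g t) \<le> e1 * norm (y - t))" for t
      using der[of t, unfolded has_vector_derivative_def has_derivative_within_alt] e1
      by (cases "t \<in> {a..b} - Z") (blast, meson zero_less_one)
    then obtain d where d0: "\<And>t. 0 < d t" and
      d: "\<And>t y. \<lbrakk>t \<in> {a..b} - Z; y \<in> {a..b}; norm (y - t) < d t\<rbrakk> \<Longrightarrow>
            norm (F y - F t - (y - t) *\<^sub>R g t) \<le> e1 * norm (y - t)"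
      by metis
    obtain d' where "d' > 0"
      and d': "\<And>(k::nat) l r. (\<forall>i<k. a \<le> l i \<and> l i \<le> r i \<and> r i \<le> b) \<Longrightarrow>
        disjoint_family_on (\<lambda>i. {l i<..<r i}) {..<k} \<Longrightarrow> (\<Sum>i<k. r i - l i) < d' \<Longrightarrow>
        (\<Sum>i<k. dist (F (r i)) (F (l i))) < e / 2"
      using ac[unfolded abs_continuous_on_interval_def, rule_format, of "e/2"] \<open>e > 0\<close> by auto
    have Zl: "Z \<in> sets lebesgue" "Z \<in> lmeasurable" "measure lebesgue Z = 0"
      using Z by (auto simp: negligible_iff_measure)
    obtain T where T: "open T" "Z \<subseteq> T" "T - Z \<in> lmeasurable" "emeasure lebesgue (T - Z) < ennreal d'"
      using sets_lebesgue_outer_open[OF Zl(1) \<open>d' > 0\<close>] by metis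
    have Tl: "T \<in> lmeasurable" "measure lebesgue T < d'"
    proof -
      have "T = (T - Z) \<union> Z" using T by auto
      then show "T \<in> lmeasurable" using T(3) Zl(2) fmeasurable.Un by metis
      have "measure lebesgue T \<le> measure lebesgue (T - Z) + measure lebesgue Z"
        using \<open>T = (T - Z) \<union> Z\<close> T(3) Zl measure_Un_le[of "T - Z" lebesgue Z] fmeasurableD by metis
      also have "\<dots> < d'"
        using T(3,4) \<open>d' > 0\<close> Zl(3)
        by (simp add: emeasure_eq_measure2 fmeasurableD2 emeasure_eq_ennreal_measure ennreal_less_iff)
      finally show "measure lebesgue T < d'" .
    qed
    have "\<exists>s>0. t \<in> Z \<longrightarrow> ball t s \<subseteq> T" for t
      using T open_contains_ball by (metis subsetD zero_less_one)
    then obtain s where s: "\<And>t. s t > 0" "\<And>t. t \<in> Z \<Longrightarrow> ball t (s t) \<subseteq> T" by metis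
    define \<gamma> where "\<gamma> t = ball t (if t \<in> Z then s t else d t)" for t
    have "gauge \<gamma>" unfolding \<gamma>_def by (intro gauge_ball_dependent) (auto simp: s d0)
    moreover have "norm ((\<Sum>(x, k)\<in>p. measure lborel k *\<^sub>R h x) - (F b - F a)) < e"
      if p: "p tagged_division_of {a..b}" and fine: "\<gamma> fine p" for p
    proof -
      have fp: "finite p" using p by blast
      define L where "L xk = Inf (snd xk)" for xk :: "real \<times> real set"
      define R where "R xk = Sup (snd xk)" for xk :: "real \<times> real set"
      have LR: "snd xk = {L xk..R xk}" "L xk \<le> fst xk" "fst xk \<le> R xk" "L xk \<le> R xk"
        "a \<le> L xk" "R xk \<le> b" if "xk \<in> p" for xk
      proof -
        obtain x K where xk: "xk = (x, K)" by force
        then have "x \<in> K" "K \<subseteq> {a..b}" "\<exists>u v. K = cbox u v"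
          using tagged_division_ofD(2-4)[OF p, of x K] that by auto
        moreover from this obtain u v where "K = {u..v}" by auto
        ultimately show "snd xk = {L xk..R xk}" "L xk \<le> fst xk" "fst xk \<le> R xk" "L xk \<le> R xk"
        "a \<le> L xk" "R xk \<le> b" unfolding L_def R_def xk by auto
      qed
      have ba: "b - a = (\<Sum>xk\<in>p. R xk - L xk)" "F b - F a = (\<Sum>xk\<in>p. F (R xk) - F (L xk))"
        using additive_tagged_division_1[where f= "\<lambda>x. x"] additive_tagged_division_1[where f= F]
          \<open>a \<le> b\<close> p by (auto simp: L_def R_def case_prod_unfold)
      define P where "P = {xk \<in> p. fst xk \<in> Z}"
      have PS: "finite P" "P \<subseteq> p" using fp by (auto simp: P_def)
      have cont: "measure lborel (snd xk) = R xk - L xk" if "xk \<in> p" for xk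
        using LR[OF that] by simp
      \<comment> \<open>Straddle estimate: the tag lies between the two ends of the cell, so the
        linearization errors on its two sides add up to \<open>e1\<close> times the full
        length.\<close>
      have good: "norm ((R xk - L xk) *\<^sub>R h (fst xk) - (F (R xk) - F (L xk))) \<le> e1 * (R xk - L xk)"
        if xk: "xk \<in> p - P" for xk
      proof -
        let ?x = "fst xk"
        have *: "?x \<in> {a..b} - Z" "L xk \<in> {a..b}" "R xk \<in> {a..b}"
          using xk LR[of xk] by (auto simp: P_def)
        have "snd xk \<subseteq> ball ?x (d ?x)"
          using fineD[OF fine, of ?x "snd xk"] xk * by (simp add: \<gamma>_def)
        then have "L xk \<in> ball ?x (d ?x)" "R xk \<in> ball ?x (d ?x)"
          using LR(1,4)[of xk] xk by (simp_all only: subset_eq) auto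
        then have "norm (L xk - ?x) < d ?x" "norm (R xk - ?x) < d ?x"
          by (auto simp: dist_norm norm_minus_commute)
        then have "norm (F (L xk) - F ?x - (L xk - ?x) *\<^sub>R g ?x) \<le> e1 * norm (L xk - ?x)"
          "norm (F (R xk) - F ?x - (R xk - ?x) *\<^sub>R g ?x) \<le> e1 * norm (R xk - ?x)"
          using d * by blast+
        moreover have "norm ((R xk - L xk) *\<^sub>R h ?x - (F (R xk) - F (L xk))) \<le>
          norm (F (L xk) - F ?x - (L xk - ?x) *\<^sub>R g ?x) + norm (F (R xk) - F ?x - (R xk - ?x) *\<^sub>R g ?x)"
        proof -
          have "(R xk - L xk) *\<^sub>R h ?x - (F (R xk) - F (L xk)) =
            (F (L xk) - F ?x - (L xk - ?x) *\<^sub>R g ?x) - (F (R xk) - F ?x - (R xk - ?x) *\<^sub>R g ?x)"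
            using * by (simp add: h_def algebra_simps)
          then show ?thesis by (metis norm_triangle_ineq4)
        qed
        moreover have "norm (L xk - ?x) + norm (R xk - ?x) = R xk - L xk"
          using LR[of xk] xk by auto
        ultimately show ?thesis by (smt (verit) distrib_left)
      qed
      have bad: "(\<Sum>xk\<in>P. norm (F (R xk) - F (L xk))) < e / 2"
      proof -
        \<comment> \<open>Absolute continuity speaks of intervals indexed by an initial segment of
          the naturals, so the cells tagged in \<open>Z\<close> are enumerated.\<close>
        obtain \<phi> where \<phi>: "bij_betw \<phi> {..<card P} P"
          using ex_bij_betw_nat_finite[OF PS(1)] by (auto simp: atLeast0LessThan)
        then have \<phi>P: "\<phi> i \<in> P" "\<phi> i \<in> p" if "i < card P" for i
          using that PS by (auto simp: bij_betw_def)
        have disj: "disjoint_family_on (\<lambda>i. {L (\<phi> i)<..<R (\<phi> i)}) {..<card P}"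
          unfolding disjoint_family_on_def
        proof (intro ballI impI)
          fix i j assume ij: "i \<in> {..<card P}" "j \<in> {..<card P}" "i \<noteq> j"
          then have "\<phi> i \<noteq> \<phi> j" using \<phi> by (auto simp: bij_betw_def inj_on_def)
          moreover have "\<phi> i \<in> p" "\<phi> j \<in> p" using \<phi>P ij by auto
          ultimately have "interior (snd (\<phi> i)) \<inter> interior (snd (\<phi> j)) = {}"
            using tagged_division_ofD(5)[OF p, of "fst (\<phi> i)" "snd (\<phi> i)" "fst (\<phi> j)" "snd (\<phi> j)"] by simp
          then show "{L (\<phi> i)<..<R (\<phi> i)} \<inter> {L (\<phi> j)<..<R (\<phi> j)} = {}"
            using LR(1) \<open>\<phi> i \<in> p\<close> \<open>\<phi> j \<in> p\<close> by (simp add: interior_atLeastAtMost_real)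
        qed
        have "(\<Sum>i<card P. R (\<phi> i) - L (\<phi> i)) = (\<Sum>i<card P. measure lebesgue {L (\<phi> i)<..<R (\<phi> i)})"
          using LR(4) \<phi>P(2) by (intro sum.cong) simp_all
        also have "\<dots> = measure lebesgue (\<Union>i<card P. {L (\<phi> i)<..<R (\<phi> i)})"
        proof (rule measure_finite_Union[symmetric])
          show "emeasure lebesgue {L (\<phi> i)<..<R (\<phi> i)} \<noteq> \<infinity>" if "i \<in> {..<card P}" for i
            using LR(4)[of "\<phi> i"] \<phi>P(2)[of i] that by simp
        qed (auto simp: disj)
        also have "\<dots> \<le> measure lebesgue T"
        proof (rule measure_mono_fmeasurable)
          show "(\<Union>i<card P. {L (\<phi> i)<..<R (\<phi> i)}) \<subseteq> T"
          proof safe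
            fix i y assume "i < card P" "y \<in> {L (\<phi> i)<..<R (\<phi> i)}"
            then have "y \<in> snd (\<phi> i)" using LR(1) \<phi>P by auto
            moreover have "snd (\<phi> i) \<subseteq> ball (fst (\<phi> i)) (s (fst (\<phi> i)))"
              using fineD[OF fine, of "fst (\<phi> i)" "snd (\<phi> i)"] \<phi>P[OF \<open>i < card P\<close>] by (simp add: \<gamma>_def P_def)
            moreover have "fst (\<phi> i) \<in> Z" using \<phi>P[OF \<open>i < card P\<close>] by (auto simp: P_def)
            ultimately show "y \<in> T" using s(2) by blast
          qed
        qed (auto simp: Tl)
        also have "\<dots> < d'" by (rule Tl)
        finally have "(\<Sum>i<card P. dist (F (R (\<phi> i))) (F (L (\<phi> i)))) < e / 2"
        proof (intro d' disj allI impI conjI)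
          fix i assume "i < card P"
          then show "a \<le> L (\<phi> i)" "L (\<phi> i) \<le> R (\<phi> i)" "R (\<phi> i) \<le> b"
            using LR(4-6) \<phi>P(2) by blast+
        qed
        then show ?thesis
          using sum.reindex_bij_betw[OF \<phi>, of "\<lambda>xk. norm (F (R xk) - F (L xk))"] by (simp add: dist_norm)
      qed
      have "(\<Sum>(x, k)\<in>p. measure lborel k *\<^sub>R h x) - (F b - F a)
          = (\<Sum>xk\<in>p. (R xk - L xk) *\<^sub>R h (fst xk) - (F (R xk) - F (L xk)))"
        unfolding ba sum_subtractf case_prod_unfold using cont by simp
      also have "\<dots> = (\<Sum>xk\<in>p-P. (R xk - L xk) *\<^sub>R h (fst xk) - (F (R xk) - F (L xk)))
          + (\<Sum>xk\<in>P. (R xk - L xk) *\<^sub>R h (fst xk) - (F (R xk) - F (L xk)))"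
        using sum.subset_diff[OF PS(2) fp] .
      also have "norm \<dots> \<le> (\<Sum>xk\<in>p-P. e1 * (R xk - L xk)) + (\<Sum>xk\<in>P. norm (F (R xk) - F (L xk)))"
      proof (intro norm_triangle_mono sum_norm_le)
        fix xk assume "xk \<in> P"
        then show "norm ((R xk - L xk) *\<^sub>R h (fst xk) - (F (R xk) - F (L xk))) \<le> norm (F (R xk) - F (L xk))"
          by (auto simp: P_def h_def norm_minus_commute)
      qed (use good in blast)
      also have "(\<Sum>xk\<in>p-P. e1 * (R xk - L xk)) \<le> (\<Sum>xk\<in>p. e1 * (R xk - L xk))"
        using fp LR e1 by (intro sum_mono2) auto
      also have "\<dots> = e1 * (b - a)" by (simp add: ba(1) sum_distrib_left)
      also have "\<dots> \<le> e / 2"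
      proof -
        have "(b - a) / (b - a + 1) \<le> 1" using \<open>a \<le> b\<close> by simp
        then show ?thesis using \<open>e > 0\<close> mult_left_mono[of "(b - a) / (b - a + 1)" 1 "e/2"] by (simp add: e1_def)
      qed
      finally show ?thesis using bad by linarith
    qed
    ultimately show "\<exists>\<gamma>. gauge \<gamma> \<and> (\<forall>\<D>. \<D> tagged_division_of {a..b} \<and> \<gamma> fine \<D> \<longrightarrow>
        norm ((\<Sum>(x, k)\<in>\<D>. measure lborel k *\<^sub>R h x) - (F b - F a)) < e)"
      by (intro exI[of _ \<gamma>] conjI allI impI) auto
  qed
  then show ?thesis
    by (rule has_integral_spike[OF Z, rotated]) (auto simp: h_def)
qed

text \<open>The estimates on trajectories use the differential equation only in this form.
  Integrability of the right-hand side along the trajectory comes out as part of the conclusion,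
  since the gauge integral recovers an absolutely continuous function from its derivative.\<close>

lemma trajectory_has_integral:
  assumes x: "trajectory f a b x0 u x" and st: "a \<le> s" "s \<le> t" "t \<le> b"
  shows "((\<lambda>\<xi>. f \<xi> (x \<xi>) (u \<xi>)) has_integral x t - x s) {s..t}"
proof -
  have ac: "abs_continuous_on_interval a b x"
    and ae: "AE t in lebesgue_on {a..b}. (x has_vector_derivative f t (x t) (u t)) (at t within {a..b})"
    using x by (auto simp: trajectory_def)
  from ae obtain Z where Z: "{t \<in> space (lebesgue_on {a..b}). \<not> (x has_vector_derivative f t (x t) (u t)) (at t within {a..b})} \<subseteq> Z"
      "Z \<in> null_sets (lebesgue_on {a..b})"
    by (auto simp: eventually_ae_filter)
  then have negl: "negligible Z"
    by (simp add: null_sets_restrict_space negligible_iff_null_sets)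
  show ?thesis
  proof (rule abs_continuous_fundamental_theorem[OF _ st(2) negl])
    show "abs_continuous_on_interval s t x"
      unfolding abs_continuous_on_interval_def
    proof (intro allI impI)
      fix e :: real assume "e > 0"
      from ac[unfolded abs_continuous_on_interval_def, rule_format, OF this] obtain d where "d > 0"
        and d: "\<And>(k::nat) l r. (\<forall>i<k. a \<le> l i \<and> l i \<le> r i \<and> r i \<le> b) \<and>
          disjoint_family_on (\<lambda>i. {l i<..<r i}) {..<k} \<and> (\<Sum>i<k. r i - l i) < d \<Longrightarrow>
          (\<Sum>i<k. dist (x (r i)) (x (l i))) < e"
        by blast
      have "(\<Sum>i<k. dist (x (r i)) (x (l i))) < e"
        if "(\<forall>i<k. s \<le> l i \<and> l i \<le> r i \<and> r i \<le> t) \<and>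
          disjoint_family_on (\<lambda>i. {l i<..<r i}) {..<k} \<and> (\<Sum>i<k. r i - l i) < d" for k :: nat and l r
      proof (intro d conjI)
        show "\<forall>i<k. a \<le> l i \<and> l i \<le> r i \<and> r i \<le> b" using that st by force
      qed (use that in auto)
      with \<open>d > 0\<close> show "\<exists>d>0. \<forall>(k::nat) l r. (\<forall>i<k. s \<le> l i \<and> l i \<le> r i \<and> r i \<le> t) \<and>
          disjoint_family_on (\<lambda>i. {l i<..<r i}) {..<k} \<and> (\<Sum>i<k. r i - l i) < d \<longrightarrow>
          (\<Sum>i<k. dist (x (r i)) (x (l i))) < e" by blast
    qed
    fix y assume y: "y \<in> {s..t} - Z"
    then have "y \<in> {a..b}" using st by auto
    then have "(x has_vector_derivative f y (x y) (u y)) (at y within {a..b})"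
      using Z(1) y by (auto simp: subset_eq)
    then show "(x has_vector_derivative f y (x y) (u y)) (at y within {s..t})"
      by (rule has_vector_derivative_within_subset) (use st in auto)
  qed
qed

lemma trajectory_continuous_on:
  "trajectory f a b x0 u x \<Longrightarrow> continuous_on {a..b} x"
  by (simp add: trajectory_def abs_continuous_on_interval_imp_continuous_on)

section \<open>Gronwall's inequality\<close>

text \<open>The kernel will contain norms of controls and is merely integrable, so the integral
  bound cannot be differentiated at every point. The factor 2 in the exponent is the price of
  arguing over finite steps instead; only the existence of some uniform constant matters
  later.\<close>

lemma integral_Gronwall:
  fixes k w :: "real \<Rightarrow> real"
  assumes k: "k integrable_on {a..b}" and kw: "(\<lambda>s. k s * w s) integrable_on {a..b}"
    and k0: "\<And>s. s \<in> {a..b} \<Longrightarrow> 0 \<le> k s" and w0: "\<And>s. s \<in> {a..b} \<Longrightarrow> 0 \<le> w s"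
    and le: "\<And>t. t \<in> {a..b} \<Longrightarrow> w t \<le> \<eta> + integral {a..t} (\<lambda>s. k s * w s)"
    and t: "t \<in> {a..b}"
  shows "w t \<le> \<eta> * exp (2 * integral {a..t} k)"
proof -
  \<comment> \<open>As \<open>w \<le> m\<close> and \<open>m\<close> is increasing, \<open>m v - m u \<le> m v * (K v - K u)\<close>, which makes
    \<open>m * exp (- 2 * K)\<close> decreasing over steps on which \<open>K\<close> grows by at most 1/2.\<close>
  define K where "K t = integral {a..t} k" for t
  define m where "m t = \<eta> + integral {a..t} (\<lambda>s. k s * w s)" for t
  have Kd: "integral {u..v} k = K v - K u" and md: "integral {u..v} (\<lambda>s. k s * w s) = m v - m u"
    if "a \<le> u" "u \<le> v" "v \<le> b" for u v
    using that Henstock_Kurzweil_Integration.integral_combine[where a=a and c=u and b=v and f=k] Henstock_Kurzweil_Integration.integral_combine[where a=a and c=u and b=v and f="\<lambda>s. k s * w s"]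
      integrable_subinterval_real[OF k, of a v] integrable_subinterval_real[OF kw, of a v]
    by (auto simp: K_def m_def)
  have mmono: "m u \<le> m v" and Kmono: "K u \<le> K v" if "a \<le> u" "u \<le> v" "v \<le> b" for u v
  proof -
    have "0 \<le> integral {u..v} (\<lambda>s. k s * w s)" "0 \<le> integral {u..v} k"
      using that k0 w0 integrable_subinterval_real[OF k, of u v] integrable_subinterval_real[OF kw, of u v]
      by (auto intro!: integral_nonneg)
    then show "m u \<le> m v" "K u \<le> K v" using Kd md that by auto
  qed
  have wm: "w s \<le> m s" if "s \<in> {a..b}" for s using le[OF that] by (simp add: m_def)
  have step: "m v * exp (- 2 * K v) \<le> m u * exp (- 2 * K u)"
    if uv: "a \<le> u" "u \<le> v" "v \<le> b" and K2: "K v - K u \<le> 1/2" for u v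
  proof -
    define x where "x = K v - K u"
    have x: "0 \<le> x" "x \<le> 1/2" using Kmono uv K2 by (auto simp: x_def)
    have mv: "0 \<le> m v" using w0[of v] wm[of v] uv by auto
    have "m v - m u \<le> integral {u..v} (\<lambda>s. k s * m v)"
      unfolding md[OF uv, symmetric]
    proof (rule integral_le)
      fix s assume s: "s \<in> {u..v}"
      then have "w s \<le> m v" using wm[of s] mmono[of s v] uv by auto
      then show "k s * w s \<le> k s * m v" using k0[of s] s uv by (intro mult_left_mono) auto
    qed (use uv integrable_subinterval_real[OF k, of u v] integrable_subinterval_real[OF kw, of u v] in \<open>auto intro!: integrable_on_mult_left\<close>)
    also have "\<dots> = m v * x" using Kd[OF uv] by (simp add: x_def)
    finally have 1: "m v * (1 - x) \<le> m u" by (simp add: algebra_simps)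
    \<comment> \<open>The threshold 1/2 and the factor 2 belong together:
      \<open>exp (- 2 * x) \<le> 1 - x\<close> holds for \<open>0 \<le> x \<le> 1/2\<close>.\<close>
    have "- 2 * x \<le> - x - 2 * x\<^sup>2" using x mult_left_mono[of x "1/2" x] by (simp add: power2_eq_square)
    also have "\<dots> \<le> ln (1 - x)" using ln_one_minus_pos_lower_bound x by auto
    finally have "exp (- 2 * x) \<le> 1 - x" using x by (subst (asm) ln_ge_iff) auto
    then have "m v * exp (- 2 * x) \<le> m u" using 1 mv by (meson mult_left_mono order_trans)
    then have "m v * exp (- 2 * x) * exp (- 2 * K u) \<le> m u * exp (- 2 * K u)" by simp
    then show ?thesis by (simp add: x_def mult.assoc flip: exp_add)
  qed
  have "uniformly_continuous_on {a..b} K"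
    unfolding K_def by (intro compact_uniformly_continuous indefinite_integral_continuous_1 k) auto
  then obtain d where "d > 0" and d: "\<And>s s'. s \<in> {a..b} \<Longrightarrow> s' \<in> {a..b} \<Longrightarrow> dist s' s < d \<Longrightarrow> dist (K s') (K s) < 1/2"
    unfolding uniformly_continuous_on_def by (meson half_gt_zero zero_less_one)
  \<comment> \<open>The short steps are chained by induction on how many lengths
    \<open>d / 2\<close> are needed to reach \<open>s\<close> from \<open>a\<close>; by uniform
    continuity \<open>K\<close> grows by less than 1/2 on each.\<close>
  have "m s * exp (- 2 * K s) \<le> m a * exp (- 2 * K a)" if "s \<in> {a..b}" "s - a \<le> real n * (d / 2)" for n s
    using that
  proof (induction n arbitrary: s)
    case 0
    then show ?case by auto
  next
    case (Suc n)
    define s' where "s' = max a (s - d / 2)"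
    have s': "s' \<in> {a..b}" "s' \<le> s" "dist s s' < d" "s' - a \<le> real n * (d / 2)"
      using Suc.prems \<open>d > 0\<close> mult_nonneg_nonneg[of "real n" "d / 2"]
      by (auto simp: s'_def dist_real_def algebra_simps max_def)
    then have "dist (K s) (K s') < 1/2" using d[of s' s] Suc.prems by auto
    then have "K s - K s' \<le> 1/2" unfolding dist_real_def by linarith
    then have "m s * exp (- 2 * K s) \<le> m s' * exp (- 2 * K s')" using step[of s' s] s' Suc.prems by auto
    with Suc.IH[OF s'(1,4)] show ?case by simp
  qed
  moreover obtain n where "t - a \<le> real n * (d / 2)"
    using \<open>d > 0\<close> reals_Archimedean3[of "d/2"] by (metis half_gt_zero less_imp_le)
  ultimately have "m t * exp (- 2 * K t) \<le> \<eta>" using t by (fastforce simp: m_def K_def)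
  then have "m t \<le> \<eta> * exp (2 * K t)" by (simp add: exp_minus field_simps)
  then show ?thesis using wm[OF t] by (simp add: K_def)
qed

lemma integrable_mult_continuous:
  fixes k w :: "real \<Rightarrow> real"
  assumes k: "k integrable_on {a..b}" and k0: "\<And>s. s \<in> {a..b} \<Longrightarrow> 0 \<le> k s"
    and w: "continuous_on {a..b} w"
  shows "(\<lambda>s. k s * w s) integrable_on {a..b}"
proof -
  have "k absolutely_integrable_on {a..b}"
    using k k0 by (intro nonnegative_absolutely_integrable_1) auto
  moreover have "w \<in> borel_measurable (lebesgue_on {a..b})"
    by (intro continuous_imp_measurable_on_sets_lebesgue w) auto
  moreover have "bounded (w ` {a..b})"
    by (intro compact_imp_bounded compact_continuous_image w) auto
  ultimately have "(\<lambda>s. w s * k s) absolutely_integrable_on {a..b}"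
    by (intro absolutely_integrable_bounded_measurable_product_real) auto
  then show ?thesis
    using set_lebesgue_integral_eq_integral(1) by (simp add: mult.commute)
qed

text \<open>Gronwall is applied to \<open>norm (x t) + 1\<close>, which turns affine growth into
  linear growth. The integrand \<open>h\<close> is left abstract so that the bound serves both
  trajectories of \<open>f\<close> and the solution of the truncated equation in the existence
  proof.\<close>

lemma linear_growth_bound:
  fixes x h :: "real \<Rightarrow> 'a::euclidean_space"
  assumes x: "continuous_on {a..b} x" and k: "k integrable_on {a..b}"
    and k0: "\<And>s. s \<in> {a..b} \<Longrightarrow> 0 \<le> k s"
    and h: "\<And>t. t \<in> {a..b} \<Longrightarrow> (h has_integral x t - x0) {a..t}"
    and le: "\<And>s. s \<in> {a..b} \<Longrightarrow> norm (h s) \<le> k s * (norm (x s) + 1)"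
    and t: "t \<in> {a..b}"
  shows "norm (x t) + 1 \<le> (norm x0 + 1) * exp (2 * integral {a..b} k)"
proof -
  have kw: "(\<lambda>s. k s * (norm (x s) + 1)) integrable_on {a..b}"
    by (intro integrable_mult_continuous k k0 continuous_intros x)
  have "norm (x t) + 1 \<le> (norm x0 + 1) * exp (2 * integral {a..t} k)"
  proof (rule integral_Gronwall[OF k kw k0 _ _ t])
    fix s assume s: "s \<in> {a..b}"
    have "norm (x s - x0) \<le> integral {a..s} (\<lambda>s. k s * (norm (x s) + 1))"
      unfolding integral_unique[OF h[OF s], symmetric] using s le integrable_subinterval_real[OF kw, of a s]
      by (intro integral_norm_bound_integral has_integral_integrable[OF h[OF s]]) auto
    then show "norm (x s) + 1 \<le> norm x0 + 1 + integral {a..s} (\<lambda>s. k s * (norm (x s) + 1))"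
      using norm_triangle_sub[of "x s" x0] by linarith
  qed auto
  also have "integral {a..t} k \<le> integral {a..b} k"
    using t k0 by (intro integral_subset_le integrable_subinterval_real[OF k] k) auto
  finally show ?thesis by (simp add: mult_left_mono)
qed

section \<open>Controls in the ball of \<open>L\<^sub>p\<close>\<close>

text \<open>Above the level \<open>K\<close> the factor \<open>(x / K) powr (p - 1)\<close> is at
  least 1. With \<open>K\<close> free this is a quantitative uniform integrability for the ball of
  controls.\<close>

lemma le_add_powr_divide:
  fixes x K p :: real
  assumes "0 \<le> x" "0 < K" "1 \<le> p"
  shows "x \<le> K + x powr p / K powr (p - 1)"
proof (cases "x \<le> K")
  case True
  then show ?thesis by (simp add: add_increasing2)
next
  case False
  then have "x * K powr (p - 1) \<le> x * x powr (p - 1)"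
    using assms by (intro mult_left_mono powr_mono2) auto
  also have "\<dots> = x powr p"
    using False assms powr_add[of x 1 "p - 1"] by simp
  finally have "x \<le> x powr p / K powr (p - 1)"
    using assms by (simp add: pos_le_divide_eq)
  then show ?thesis using assms by simp
qed

lemma Lp_ball_integrable_powr:
  assumes "u \<in> Lp_ball p r a b" "0 < p" "0 \<le> r"
  shows "(\<lambda>s. norm (u s) powr p) integrable_on {a..b}"
    and "integral {a..b} (\<lambda>s. norm (u s) powr p) \<le> r powr p"
proof -
  have u: "integrable (lebesgue_on {a..b}) (\<lambda>s. norm (u s) powr p)" "Lp_norm p a b u \<le> r"
    using assms by (auto simp: Lp_ball_def Lp_space_def)
  then show "(\<lambda>s. norm (u s) powr p) integrable_on {a..b}"
    by (intro integrable_on_lebesgue_on) auto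
  let ?I = "LINT s|lebesgue_on {a..b}. norm (u s) powr p"
  have "?I \<ge> 0" by (simp add: integral_nonneg_AE)
  then have "?I = (?I powr (1/p)) powr p" using assms by (simp add: powr_powr)
  also have "\<dots> \<le> r powr p" using u assms by (intro powr_mono2) (auto simp: Lp_norm_def)
  finally show "integral {a..b} (\<lambda>s. norm (u s) powr p) \<le> r powr p"
    using u by (simp add: lebesgue_integral_eq_integral)
qed

lemma Lp_space_integrable:
  assumes "u \<in> Lp_space p a b" "1 \<le> p"
  shows "integrable (lebesgue_on {a..b}) u"
proof (rule Bochner_Integration.integrable_bound)
  have "finite_measure (lebesgue_on {a..b})" by (intro finite_measure_lebesgue_on) auto
  then show "integrable (lebesgue_on {a..b}) (\<lambda>s. 1 + norm (u s) powr p)"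
    using assms by (auto simp: Lp_space_def finite_measure.integrable_const)
  show "u \<in> borel_measurable (lebesgue_on {a..b})" using assms by (auto simp: Lp_space_def)
  show "AE s in lebesgue_on {a..b}. norm (u s) \<le> norm (1 + norm (u s) powr p)"
    using le_add_powr_divide[of "norm (u _)" 1 p] assms by simp
qed

lemma Lp_ball_integrable_norm:
  assumes "u \<in> Lp_ball p r a b" "1 \<le> p"
  shows "(\<lambda>s. norm (u s)) integrable_on {a..b}"
  using Lp_space_integrable[of u p a b] assms
  by (intro integrable_on_lebesgue_on integrable_norm) (auto simp: Lp_ball_def)

text \<open>A large \<open>K\<close> makes the last term small, and then short intervals make the
  first one small: a modulus of continuity common to the whole ball.\<close>

lemma Lp_ball_integral_norm_le:
  assumes u: "u \<in> Lp_ball p r a b" "1 \<le> p" "0 \<le> r" and "0 < K" and st: "a \<le> s" "s \<le> t" "t \<le> b"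
  shows "integral {s..t} (\<lambda>\<xi>. norm (u \<xi>)) \<le> K * (t - s) + r powr p / K powr (p - 1)"
proof -
  have up: "(\<lambda>s. norm (u s) powr p) integrable_on {a..b}"
    "integral {a..b} (\<lambda>s. norm (u s) powr p) \<le> r powr p"
    using Lp_ball_integrable_powr[of u p r a b] assms by auto
  have "integral {s..t} (\<lambda>\<xi>. norm (u \<xi>)) \<le> integral {s..t} (\<lambda>\<xi>. K + norm (u \<xi>) powr p / K powr (p - 1))"
    using st assms le_add_powr_divide
    by (intro integral_le integrable_subinterval_real[OF Lp_ball_integrable_norm[OF u(1,2)]]
        integrable_add integrable_on_divide integrable_subinterval_real[OF up(1)]) auto
  also have "\<dots> = K * (t - s) + integral {s..t} (\<lambda>\<xi>. norm (u \<xi>) powr p) / K powr (p - 1)"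
    using st integrable_subinterval_real[OF up(1), of s t]
    by (subst integral_add) (auto intro!: integrable_on_divide)
  also have "integral {s..t} (\<lambda>\<xi>. norm (u \<xi>) powr p) \<le> integral {a..b} (\<lambda>\<xi>. norm (u \<xi>) powr p)"
    using st by (intro integral_subset_le integrable_subinterval_real[OF up(1)] up) auto
  also note up(2)
  finally show ?thesis by (simp add: divide_right_mono)
qed

lemma ex_powr_divide_less:
  fixes C e p :: real
  assumes "0 \<le> C" "0 < e" "1 < p"
  obtains K where "0 < K" "C / K powr (p - 1) < e"
proof
  \<comment> \<open>Chosen so that \<open>?K powr (p - 1) = C / e + 1\<close>, which exceeds
    \<open>C / e\<close>; the \<open>+ 1\<close> keeps it positive when
    \<open>C = 0\<close>.\<close>
  let ?K = "(C / e + 1) powr (1 / (p - 1))"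
  have "0 < C / e + 1" using assms by (simp add: add_nonneg_pos)
  then show "0 < ?K" by simp
  have "?K powr (p - 1) = C / e + 1" using assms \<open>0 < C / e + 1\<close> by (simp add: powr_powr)
  then show "C / ?K powr (p - 1) < e" using assms \<open>0 < C / e + 1\<close> by (simp add: field_simps)
qed

lemma Lp_ball_integral_norm_bounded:
  assumes "u \<in> Lp_ball p r a b" "1 \<le> p" "0 \<le> r" "a \<le> b"
  shows "integral {a..b} (\<lambda>s. norm (u s)) \<le> (b - a) + r powr p"
  using Lp_ball_integral_norm_le[of u p r a b 1 a b] assms by simp

section \<open>Approximation by step controls\<close>

text \<open>Two applications of dominated convergence: first \<open>u\<close> is truncated by the
  projection onto a large ball, then the truncation is approximated by continuous functions.
  Projection is continuous, so it truncates without destroying continuity.\<close>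

lemma L1_dense_continuous:
  fixes u :: "real \<Rightarrow> 'a::euclidean_space"
  assumes u: "integrable (lebesgue_on {a..b}) u" and "0 < e"
  obtains g where "continuous_on UNIV g" "(LINT s|lebesgue_on {a..b}. norm (u s - g s)) < e"
    "integrable (lebesgue_on {a..b}) (\<lambda>s. u s - g s)"
proof -
  let ?M = "lebesgue_on {a..b}"
  let ?P = "\<lambda>n. closest_point (cball (0::'a) (real n))"
  have Pcont: "continuous_on UNIV (?P n)" for n
    by (intro continuous_on_closest_point) auto
  have Pdist: "dist (?P n x) (?P n y) \<le> dist x y" for n x y
    by (intro closest_point_lipschitz) auto
  have Pself: "?P n x = x" if "norm x \<le> real n" for n x
    using that by (intro closest_point_self) auto
  have Pbound: "norm (?P n x) \<le> real n" for n x
    using closest_point_in_set[of "cball (0::'a) (real n)" x] by auto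
  have Pnorm: "norm (?P n x) \<le> norm x" for n x
    using Pdist[of n x 0] Pself[of 0 n] by simp
  have um: "u \<in> borel_measurable ?M" using u by auto
  have Pm: "(\<lambda>s. ?P n (u s)) \<in> borel_measurable ?M" for n
    by (rule borel_measurable_continuous_on[OF Pcont um])
  have "(\<lambda>n. LINT s|?M. norm (u s - ?P n (u s))) \<longlonglongrightarrow> (LINT s|?M. 0)"
  proof (rule integral_dominated_convergence[where w="\<lambda>s. 2 * norm (u s)"])
    show "AE s in ?M. (\<lambda>n. norm (u s - ?P n (u s))) \<longlonglongrightarrow> 0"
    proof (intro AE_I2 tendsto_eventually)
      fix s
      have "\<forall>\<^sub>F n in sequentially. norm (u s) \<le> real n"
        using filterlim_real_sequentially by (simp add: filterlim_at_top)
      then show "\<forall>\<^sub>F n in sequentially. norm (u s - ?P n (u s)) = 0"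
        by eventually_elim (simp add: Pself)
    qed
    show "AE s in ?M. norm (norm (u s - ?P n (u s))) \<le> 2 * norm (u s)" for n
    proof (intro AE_I2)
      fix s
      show "norm (norm (u s - ?P n (u s))) \<le> 2 * norm (u s)"
        using norm_triangle_ineq4[of "u s" "?P n (u s)"] Pnorm[of n "u s"] by simp
    qed
  qed (use u um Pm in auto)
  then obtain n where n: "(LINT s|?M. norm (u s - ?P n (u s))) < e / 2"
    using order_tendstoD(2)[of _ "0::real" sequentially "e/2"] \<open>0 < e\<close>
    by (auto simp: eventually_sequentially)
  have fin: "finite_measure ?M" by (intro finite_measure_lebesgue_on) auto
  have Pint: "integrable ?M (\<lambda>s. ?P n (u s))"
    using Pm Pbound by (intro finite_measure.integrable_const_bound[OF fin, of _ "real n"]) auto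
  have "(\<lambda>s. if s \<in> {a..b} then u s else 0) \<in> borel_measurable lebesgue"
    using um by (intro borel_measurable_if_I) auto
  then have "(\<lambda>s. if s \<in> {a..b} then u s else 0) measurable_on UNIV"
    by (intro lebesgue_measurable_imp_measurable_on) auto
  then obtain N g where N: "negligible N" and g: "\<And>k. continuous_on UNIV (g k :: real \<Rightarrow> 'a)"
    and lim: "\<And>s. s \<notin> N \<Longrightarrow> (\<lambda>k. g k s) \<longlonglongrightarrow> (if s \<in> {a..b} then u s else 0)"
    unfolding measurable_on_def by auto
  \<comment> \<open>The continuous functions \<open>g k\<close> converge almost everywhere but come
    without a bound; projecting them supplies a constant dominating function and fixes the limit
    \<open>?P n (u s)\<close>.\<close>
  define h where "h k s = ?P n (g k s)" for k s
  have h: "continuous_on UNIV (h k)" for k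
    unfolding h_def using continuous_on_compose2[OF Pcont g] by auto
  then have hm: "h k \<in> borel_measurable ?M" for k
    by (intro continuous_imp_measurable_on_sets_lebesgue continuous_on_subset[OF h]) auto
  have hint: "integrable ?M (h k)" for k
    using hm Pbound by (intro finite_measure.integrable_const_bound[OF fin, of _ "real n"]) (auto simp: h_def)
  have "(\<lambda>k. LINT s|?M. norm (?P n (u s) - h k s)) \<longlonglongrightarrow> (LINT s|?M. 0)"
  proof (rule integral_dominated_convergence[where w="\<lambda>s. 2 * real n"])
    show "AE s in ?M. (\<lambda>k. norm (?P n (u s) - h k s)) \<longlonglongrightarrow> 0"
    proof (rule AE_I'[of "N \<inter> {a..b}"])
      have "N \<inter> {a..b} \<in> null_sets lebesgue"
        using N by (meson inf_le1 negligible_iff_null_sets negligible_subset)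
      then show "N \<inter> {a..b} \<in> null_sets ?M" by (simp add: null_sets_restrict_space)
      have "(\<lambda>k. norm (?P n (u s) - h k s)) \<longlonglongrightarrow> 0" if s: "s \<notin> N" "s \<in> {a..b}" for s
      proof -
        have "(\<lambda>k. g k s) \<longlonglongrightarrow> u s" using lim[OF s(1)] s(2) by simp
        then have "(\<lambda>k. h k s) \<longlonglongrightarrow> ?P n (u s)"
          unfolding h_def using Pcont by (auto intro!: continuous_on_tendsto_compose[OF Pcont])
        then have "(\<lambda>k. norm (?P n (u s) - h k s)) \<longlonglongrightarrow> norm (?P n (u s) - ?P n (u s))"
          by (intro tendsto_intros)
        then show ?thesis by simp
      qed
      then show "{s \<in> space ?M. \<not> (\<lambda>k. norm (?P n (u s) - h k s)) \<longlonglongrightarrow> 0} \<subseteq> N \<inter> {a..b}" by auto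
    qed
    show "AE s in ?M. norm (norm (?P n (u s) - h k s)) \<le> 2 * real n" for k
    proof (intro AE_I2)
      fix s
      show "norm (norm (?P n (u s) - h k s)) \<le> 2 * real n"
        using norm_triangle_ineq4[of "?P n (u s)" "h k s"] Pbound[of n "u s"] Pbound[of n "g k s"]
        by (simp add: h_def)
    qed
  qed (use Pm hm fin in \<open>auto simp: finite_measure.integrable_const\<close>)
  then obtain k where k: "(LINT s|?M. norm (?P n (u s) - h k s)) < e / 2"
    using order_tendstoD(2)[of _ "0::real" sequentially "e/2"] \<open>0 < e\<close>
    by (auto simp: eventually_sequentially)
  have "(LINT s|?M. norm (u s - h k s)) \<le> (LINT s|?M. norm (u s - ?P n (u s)) + norm (?P n (u s) - h k s))"
    using u Pint hint
    by (intro integral_mono) (auto intro!: Bochner_Integration.integrable_add Bochner_Integration.integrable_diff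
        integrable_norm order_trans[OF _ norm_triangle_ineq])
  also have "\<dots> = (LINT s|?M. norm (u s - ?P n (u s))) + (LINT s|?M. norm (?P n (u s) - h k s))"
    using u Pint hint by (intro Bochner_Integration.integral_add) auto
  also have "\<dots> < e" using n k by simp
  finally show thesis using that[of "h k"] h u hint by auto
qed

section \<open>Arithmetic of uniform partitions\<close>

lemma uniform_partition_nth:
  assumes "uniform_partition a b d N \<tau>" "i \<le> N"
  shows "\<tau> i = a + real i * d"
  using assms(2)
proof (induction i)
  case (Suc i)
  then have "\<tau> (Suc i) - \<tau> i = d" using assms(1) by (auto simp only: uniform_partition_def Suc_le_eq)
  with Suc show ?case by (simp add: algebra_simps)
qed (use assms in \<open>simp add: uniform_partition_def\<close>)

lemma uniform_partition_end:
  assumes "uniform_partition a b d N \<tau>"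
  shows "b = a + real N * d"
  using uniform_partition_nth[OF assms, of N] assms by (simp add: uniform_partition_def)

lemma uniform_partition_bounds:
  assumes "uniform_partition a b d N \<tau>" "0 < d" "i < N"
  shows "a \<le> \<tau> i" "\<tau> i < \<tau> (Suc i)" "\<tau> (Suc i) \<le> b" "\<tau> (Suc i) - \<tau> i = d"
proof -
  have "real (Suc i) * d \<le> real N * d" using assms by (intro mult_right_mono) auto
  then show "a \<le> \<tau> i" "\<tau> i < \<tau> (Suc i)" "\<tau> (Suc i) \<le> b" "\<tau> (Suc i) - \<tau> i = d"
    using assms uniform_partition_nth[OF assms(1), of i] uniform_partition_nth[OF assms(1), of "Suc i"]
      uniform_partition_end[OF assms(1)] by (auto simp: algebra_simps)
qed

lemma uniform_partition_cell:
  assumes "uniform_partition a b d N \<tau>" "0 < d" "a \<le> t" "t < b"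
  obtains i where "i < N" "t \<in> {\<tau> i..<\<tau> (Suc i)}"
proof -
  define i where "i = nat \<lfloor>(t - a) / d\<rfloor>"
  have i: "real i \<le> (t - a) / d" "(t - a) / d < real i + 1"
    using assms unfolding i_def by (auto simp: of_nat_nat)
  then have "real i * d \<le> t - a" "t - a < (real i + 1) * d" using assms by (auto simp: field_simps)
  moreover have "i < N"
  proof -
    have "real i * d < real N * d" using calculation uniform_partition_end[OF assms(1)] assms by linarith
    then show ?thesis using assms by simp
  qed
  ultimately show thesis
    using uniform_partition_nth[OF assms(1), of i] uniform_partition_nth[OF assms(1), of "Suc i"]
    by (intro that[of i]) (auto simp: algebra_simps)
qed

lemma uniform_partition_cell_unique:
  assumes "uniform_partition a b d N \<tau>" "0 < d" "i < N" "j < N"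
    "t \<in> {\<tau> i..<\<tau> (Suc i)}" "t \<in> {\<tau> j..<\<tau> (Suc j)}"
  shows "i = j"
proof -
  have "real i * d < (real j + 1) * d" "real j * d < (real i + 1) * d"
    using assms uniform_partition_nth[OF assms(1), of i] uniform_partition_nth[OF assms(1), of "Suc i"]
      uniform_partition_nth[OF assms(1), of j] uniform_partition_nth[OF assms(1), of "Suc j"]
    by (auto simp: algebra_simps)
  then have "real i < real j + 1" "real j < real i + 1" using assms(2) by auto
  then show ?thesis by linarith
qed

lemma uniform_partition_sum_integral:
  fixes h :: "real \<Rightarrow> 'a::banach"
  assumes P: "uniform_partition a b d N \<tau>" "0 < d" and h: "h integrable_on {a..b}"
  shows "(\<Sum>i<N. integral {\<tau> i..\<tau> (Suc i)} h) = integral {a..b} h"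
proof -
  have "(\<Sum>i<n. integral {\<tau> i..\<tau> (Suc i)} h) = integral {a..\<tau> n} h" if "n \<le> N" for n
    using that
  proof (induction n)
    case 0
    then show ?case using P by (simp add: uniform_partition_def)
  next
    case (Suc n)
    have n: "a \<le> \<tau> n" "\<tau> n < \<tau> (Suc n)" "\<tau> (Suc n) \<le> b"
      using uniform_partition_bounds[OF P, of n] Suc.prems by auto
    then have "integral {a..\<tau> n} h + integral {\<tau> n..\<tau> (Suc n)} h = integral {a..\<tau> (Suc n)} h"
      by (intro Henstock_Kurzweil_Integration.integral_combine integrable_subinterval_real[OF h]) auto
    with Suc show ?case by simp
  qed
  from this[of N] show ?thesis using P by (simp add: uniform_partition_def)
qed

section \<open>Averages over cells: L1 convergence and Jensen's inequality\<close>

lemma integrable_lebesgue_on_absolutely: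
  fixes u :: "real \<Rightarrow> 'a::euclidean_space"
  assumes "integrable (lebesgue_on {a..b}) u" "a \<le> s" "t \<le> b"
  shows "u absolutely_integrable_on {s..t}"
proof -
  have "u absolutely_integrable_on {a..b}"
    using assms(1) by (simp add: set_integrable_def integrable_restrict_space)
  then show ?thesis by (rule absolutely_integrable_on_subinterval) (use assms in auto)
qed

lemma absolutely_integrable_norm_diff_const:
  fixes u :: "real \<Rightarrow> 'a::euclidean_space"
  assumes "u absolutely_integrable_on {s..t}"
  shows "(\<lambda>\<xi>. norm (u \<xi> - c)) integrable_on {s..t}"
proof -
  have "(\<lambda>\<xi>. u \<xi> - c) absolutely_integrable_on {s..t}"
    using assms by (intro set_integral_diff) auto
  then show ?thesis by (simp add: absolutely_integrable_on_def)
qed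

text \<open>The distance from \<open>c\<close> to the average is at most the mean of
  \<open>norm (u \<xi> - c)\<close>, so up to a factor 2 the average is as good as the best
  constant. This permits comparison with any convenient constant.\<close>

lemma integral_norm_diff_average_le:
  fixes u :: "real \<Rightarrow> 'a::euclidean_space"
  assumes u: "u absolutely_integrable_on {s..t}" and "s < t"
  defines "A \<equiv> (1 / (t - s)) *\<^sub>R integral {s..t} u"
  shows "integral {s..t} (\<lambda>\<xi>. norm (u \<xi> - A)) \<le> 2 * integral {s..t} (\<lambda>\<xi>. norm (u \<xi> - c))"
proof -
  have uint: "u integrable_on {s..t}" using u by (rule absolutely_integrable_on_def[THEN iffD1, THEN conjunct1])
  have ic: "(\<lambda>\<xi>. norm (u \<xi> - c)) integrable_on {s..t}" for c
    by (rule absolutely_integrable_norm_diff_const[OF u])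
  have "(t - s) *\<^sub>R (A - c) = integral {s..t} (\<lambda>\<xi>. u \<xi> - c)"
    using \<open>s < t\<close> uint by (subst integral_diff) (auto simp: A_def scaleR_diff_right)
  then have "(t - s) * norm (c - A) = norm (integral {s..t} (\<lambda>\<xi>. u \<xi> - c))"
    using \<open>s < t\<close> by (metis abs_of_pos diff_gt_0_iff_gt norm_minus_commute norm_scaleR)
  also have "\<dots> \<le> integral {s..t} (\<lambda>\<xi>. norm (u \<xi> - c))"
    using uint ic by (intro integral_norm_bound_integral integrable_diff) auto
  finally have A: "(t - s) * norm (c - A) \<le> integral {s..t} (\<lambda>\<xi>. norm (u \<xi> - c))" .
  have "integral {s..t} (\<lambda>\<xi>. norm (u \<xi> - A)) \<le> integral {s..t} (\<lambda>\<xi>. norm (u \<xi> - c) + norm (c - A))"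
    using norm_triangle_ineq[of "u _ - c" "c - A"] by (intro integral_le ic integrable_add) auto
  also have "\<dots> = integral {s..t} (\<lambda>\<xi>. norm (u \<xi> - c)) + (t - s) * norm (c - A)"
    using ic \<open>s < t\<close> by (subst integral_add) auto
  finally show ?thesis using A by linarith
qed

text \<open>A continuous L1 approximation \<open>g\<close> of \<open>u\<close> is nearly constant on
  short cells, so on each cell the average of \<open>u\<close> is compared with the constant
  \<open>g (\<tau> i)\<close>.\<close>

lemma step_average_L1_convergence:
  fixes u :: "real \<Rightarrow> 'a::euclidean_space"
  assumes u: "integrable (lebesgue_on {a..b}) u" and "a < b" "0 < e"
  obtains d where "0 < d" "\<And>\<Delta> N \<tau>. 0 < \<Delta> \<Longrightarrow> \<Delta> \<le> d \<Longrightarrow> uniform_partition a b \<Delta> N \<tau> \<Longrightarrow>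
     (\<Sum>i<N. integral {\<tau> i..\<tau> (Suc i)} (\<lambda>s. norm (u s - (1 / \<Delta>) *\<^sub>R integral {\<tau> i..\<tau> (Suc i)} u))) \<le> e"
proof -
  obtain g where g: "continuous_on UNIV g"
    and ug: "(LINT s|lebesgue_on {a..b}. norm (u s - g s)) < e / 4" "integrable (lebesgue_on {a..b}) (\<lambda>s. u s - g s)"
    using L1_dense_continuous[OF u, of "e/4"] \<open>0 < e\<close> by auto
  have ugi: "(\<lambda>s. norm (u s - g s)) integrable_on {a..b}"
    by (intro integrable_on_lebesgue_on integrable_norm ug) auto
  have ug': "integral {a..b} (\<lambda>s. norm (u s - g s)) < e / 4"
    using ug(1) integrable_norm[OF ug(2)] by (simp add: lebesgue_integral_eq_integral)
  \<comment> \<open>The factor 2 from the comparison with a constant doubles both errors: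
    \<open>e / 4\<close> from replacing \<open>u\<close> by \<open>g\<close>, and
    \<open>(b - a) * w = e / 4\<close> from the oscillation of \<open>g\<close>.\<close>
  define w where "w = e / (4 * (b - a))"
  have w: "w > 0" "(b - a) * w = e / 4" using assms unfolding w_def by (auto simp: divide_simps)
  have "uniformly_continuous_on {a..b} g"
    by (intro compact_uniformly_continuous continuous_on_subset[OF g]) auto
  then obtain d where "0 < d" and d: "\<And>s t. s \<in> {a..b} \<Longrightarrow> t \<in> {a..b} \<Longrightarrow> dist t s < d \<Longrightarrow> dist (g t) (g s) < w"
    using w(1) unfolding uniformly_continuous_on_def by meson
  show thesis
  proof (rule that[of "d/2"])
    show "0 < d / 2" using \<open>0 < d\<close> by simp
    fix \<Delta> N \<tau> assume \<Delta>: "0 < \<Delta>" "\<Delta> \<le> d / 2" and P: "uniform_partition a b \<Delta> N \<tau>"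
    have "integral {\<tau> i..\<tau> (Suc i)} (\<lambda>s. norm (u s - (1 / \<Delta>) *\<^sub>R integral {\<tau> i..\<tau> (Suc i)} u))
      \<le> 2 * integral {\<tau> i..\<tau> (Suc i)} (\<lambda>s. norm (u s - g s)) + 2 * (\<Delta> * w)" if "i < N" for i
    proof -
      note i = uniform_partition_bounds[OF P \<Delta>(1) that]
      have ui: "u absolutely_integrable_on {\<tau> i..\<tau> (Suc i)}"
        using i by (intro integrable_lebesgue_on_absolutely[OF u]) auto
      have ugi': "(\<lambda>s. norm (u s - g s)) integrable_on {\<tau> i..\<tau> (Suc i)}"
        using i by (intro integrable_subinterval_real[OF ugi]) auto
      have "integral {\<tau> i..\<tau> (Suc i)} (\<lambda>s. norm (u s - (1 / \<Delta>) *\<^sub>R integral {\<tau> i..\<tau> (Suc i)} u))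
        \<le> 2 * integral {\<tau> i..\<tau> (Suc i)} (\<lambda>s. norm (u s - g (\<tau> i)))"
        using integral_norm_diff_average_le[OF ui i(2), of "g (\<tau> i)"] unfolding i(4) .
      also have "integral {\<tau> i..\<tau> (Suc i)} (\<lambda>s. norm (u s - g (\<tau> i))) \<le>
          integral {\<tau> i..\<tau> (Suc i)} (\<lambda>s. norm (u s - g s) + w)"
      proof (intro integral_le absolutely_integrable_norm_diff_const[OF ui] integrable_add ugi')
        fix s assume "s \<in> {\<tau> i..\<tau> (Suc i)}"
        then have "dist (g s) (g (\<tau> i)) < w"
          using i \<Delta> \<open>0 < d\<close> by (intro d) (auto simp: dist_real_def)
        then show "norm (u s - g (\<tau> i)) \<le> norm (u s - g s) + w"
          using norm_triangle_ineq[of "u s - g s" "g s - g (\<tau> i)"] by (simp add: dist_norm)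
      qed auto
      also have "\<dots> = integral {\<tau> i..\<tau> (Suc i)} (\<lambda>s. norm (u s - g s)) + \<Delta> * w"
        using ugi' i by (subst integral_add) auto
      finally show ?thesis by simp
    qed
    then have "(\<Sum>i<N. integral {\<tau> i..\<tau> (Suc i)} (\<lambda>s. norm (u s - (1 / \<Delta>) *\<^sub>R integral {\<tau> i..\<tau> (Suc i)} u)))
      \<le> (\<Sum>i<N. 2 * integral {\<tau> i..\<tau> (Suc i)} (\<lambda>s. norm (u s - g s)) + 2 * (\<Delta> * w))"
      by (intro sum_mono) auto
    also have "\<dots> = 2 * integral {a..b} (\<lambda>s. norm (u s - g s)) + 2 * (real N * \<Delta> * w)"
      using uniform_partition_sum_integral[OF P \<Delta>(1) ugi]
      by (simp add: sum.distrib flip: sum_distrib_left)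
    also have "real N * \<Delta> * w = e / 4"
    proof -
      have "real N * \<Delta> = b - a" using uniform_partition_end[OF P] by simp
      then show ?thesis using w(2) by simp
    qed
    finally show "(\<Sum>i<N. integral {\<tau> i..\<tau> (Suc i)} (\<lambda>s. norm (u s - (1 / \<Delta>) *\<^sub>R integral {\<tau> i..\<tau> (Suc i)} u))) \<le> e"
      using ug' by linarith
  qed
qed

text \<open>The graph of \<open>x powr p\<close> lies above its tangent at \<open>m\<close>. Young's
  inequality with the conjugate exponents \<open>p\<close> and \<open>p / (p - 1)\<close> gives this
  without differentiation, also at \<open>m = 0\<close>.\<close>

lemma powr_tangent_le:
  fixes x m p :: real
  assumes "0 \<le> x" "0 \<le> m" "1 < p"
  shows "p * m powr (p - 1) * x \<le> x powr p + (p - 1) * m powr p"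
proof -
  have "x * m powr (p - 1) \<le> x powr p / p + (m powr (p - 1)) powr (p / (p - 1)) / (p / (p - 1))"
    using assms by (intro Youngs_inequality) (auto simp: field_simps)
  also have "(m powr (p - 1)) powr (p / (p - 1)) = m powr p" using assms by (simp add: powr_powr)
  finally show ?thesis using assms by (simp add: field_simps)
qed

text \<open>Jensen's inequality: the tangent inequality at the norm \<open>m\<close> of the average
  is integrated over the cell, and \<open>p - 1\<close> of the \<open>p\<close> copies of
  \<open>(t - s) * m powr p\<close> cancel.\<close>

lemma average_powr_le:
  fixes u :: "real \<Rightarrow> 'a::euclidean_space"
  assumes u: "u absolutely_integrable_on {s..t}" and up: "(\<lambda>\<xi>. norm (u \<xi>) powr p) integrable_on {s..t}"
    and "s < t" "1 < p"
  shows "(t - s) * norm ((1 / (t - s)) *\<^sub>R integral {s..t} u) powr p \<le> integral {s..t} (\<lambda>\<xi>. norm (u \<xi>) powr p)"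
proof -
  define m where "m = norm ((1 / (t - s)) *\<^sub>R integral {s..t} u)"
  have m: "0 \<le> m" by (simp add: m_def)
  have ui: "u integrable_on {s..t}" "(\<lambda>\<xi>. norm (u \<xi>)) integrable_on {s..t}"
    using u by (auto simp: absolutely_integrable_on_def)
  have "(t - s) * m \<le> integral {s..t} (\<lambda>\<xi>. norm (u \<xi>))"
    using integral_norm_bound_integral[OF ui] \<open>s < t\<close> by (simp add: m_def)
  then have "p * m powr (p - 1) * ((t - s) * m) \<le> p * m powr (p - 1) * integral {s..t} (\<lambda>\<xi>. norm (u \<xi>))"
    using \<open>1 < p\<close> by (intro mult_left_mono) auto
  also have "\<dots> = integral {s..t} (\<lambda>\<xi>. p * m powr (p - 1) * norm (u \<xi>))" by simp
  also have "\<dots> \<le> integral {s..t} (\<lambda>\<xi>. norm (u \<xi>) powr p + (p - 1) * m powr p)"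
    using powr_tangent_le[OF norm_ge_zero m \<open>1 < p\<close>]
    by (intro integral_le integrable_add up integrable_on_mult_right ui) auto
  also have "\<dots> = integral {s..t} (\<lambda>\<xi>. norm (u \<xi>) powr p) + (t - s) * ((p - 1) * m powr p)"
    using up \<open>s < t\<close> by (subst integral_add) auto
  also have "p * m powr (p - 1) * ((t - s) * m) = p * (t - s) * m powr p"
    using m \<open>1 < p\<close> powr_add[of m "p - 1" 1] by (cases "m = 0") auto
  finally show ?thesis unfolding m_def by (simp add: algebra_simps)
qed

section \<open>Rounding to the grid and properties of step controls\<close>

lemma sphere_net_nonempty:
  fixes S :: "'a::euclidean_space set"
  assumes "sphere_net \<sigma> S"
  shows "S \<noteq> {}"
proof -
  obtain s :: 'a where "s \<in> Basis" using nonempty_Basis by blast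
  then have "s \<in> sphere 0 1" by simp
  then show ?thesis using assms unfolding sphere_net_def by blast
qed

text \<open>
  Radii are rounded down, so that the constraint on the \<open>L\<^sub>p\<close> norm survives; capping them at \<open>\<beta>\<close>
  costs at most \<open>(norm c - \<beta>)\<^sup>+ \<le> norm c powr p / \<beta> powr (p - 1)\<close>.
\<close>

lemma round_to_grid:
  fixes c :: "'a::euclidean_space" and S :: "'a set"
  assumes P: "uniform_partition 0 \<beta> \<delta> q \<rho>" and "0 < \<delta>" "0 < \<beta>" and S: "sphere_net \<sigma> S" and "0 \<le> \<sigma>" "1 \<le> p"
  obtains j v where "j \<le> q" "v \<in> S" "0 \<le> \<rho> j" "\<rho> j \<le> norm c"
    "norm (\<rho> j *\<^sub>R v - c) \<le> \<delta> + \<beta> * \<sigma> + norm c powr p / \<beta> powr (p - 1)"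
proof -
  define m where "m = min (norm c) \<beta>"
  have m: "0 \<le> m" "m \<le> norm c" "m \<le> \<beta>" "norm c - m \<le> norm c powr p / \<beta> powr (p - 1)"
    using \<open>0 < \<beta>\<close> le_add_powr_divide[of "norm c" \<beta> p] \<open>1 \<le> p\<close> by (auto simp: m_def min_def)
  obtain j where j: "j \<le> q" "\<rho> j \<le> m" "m \<le> \<rho> j + \<delta>" "0 \<le> \<rho> j"
  proof (cases "m < \<beta>")
    case True
    then obtain i where i: "i < q" "m \<in> {\<rho> i..<\<rho> (Suc i)}"
      using uniform_partition_cell[OF P \<open>0 < \<delta>\<close> m(1)] by blast
    then show thesis
      using uniform_partition_bounds[OF P \<open>0 < \<delta>\<close> i(1)] by (intro that[of i]) auto
  next
    \<comment> \<open>The top radius \<open>\<rho> q = \<beta>\<close> lies in no half-open cell of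
      the grid and is treated apart.\<close>
    case False
    then show thesis using P m \<open>0 < \<delta>\<close> \<open>0 < \<beta>\<close> by (intro that[of q]) (auto simp: uniform_partition_def)
  qed
  have "\<exists>v\<in>S. norm (norm c *\<^sub>R v - c) \<le> norm c * \<sigma>"
  proof (cases "c = 0")
    case True
    then show ?thesis using sphere_net_nonempty[OF S] by auto
  next
    case False
    then have "(1 / norm c) *\<^sub>R c \<in> sphere 0 1" by simp
    then obtain v where v: "v \<in> S" "dist ((1 / norm c) *\<^sub>R c) v \<le> \<sigma>"
      using S unfolding sphere_net_def by blast
    have "norm (norm c *\<^sub>R v - c) = norm (norm c *\<^sub>R (v - (1 / norm c) *\<^sub>R c))"
      using False by (simp add: scaleR_diff_right)
    also have "\<dots> = norm c * dist ((1 / norm c) *\<^sub>R c) v"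
      by (simp add: dist_norm norm_minus_commute)
    finally have "norm (norm c *\<^sub>R v - c) \<le> norm c * \<sigma>" using v(2) by (simp add: mult_left_mono)
    then show ?thesis using v(1) by blast
  qed
  then obtain v where v: "v \<in> S" "norm (norm c *\<^sub>R v - c) \<le> norm c * \<sigma>" by blast
  have nv: "norm v = 1" using v(1) S by (auto simp: sphere_net_def)
  have "norm (\<rho> j *\<^sub>R v - c) \<le> \<rho> j * \<sigma> + (norm c - \<rho> j)"
  proof (cases "c = 0")
    case True
    then have "\<rho> j = 0" using j m by simp
    then show ?thesis using True by simp
  next
    case False
    \<comment> \<open>Passing through the intermediate point \<open>\<theta> *\<^sub>R c\<close> of
      norm \<open>\<rho> j\<close> weights the directional error by \<open>\<rho> j\<close>, which
      is at most \<open>\<beta>\<close>, and not by the unbounded \<open>norm c\<close>.\<close>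
    define \<theta> where "\<theta> = \<rho> j / norm c"
    have \<theta>: "0 \<le> \<theta>" "\<theta> \<le> 1" "\<theta> * norm c = \<rho> j" using False j m by (auto simp: \<theta>_def)
    have "\<rho> j *\<^sub>R v - c = \<theta> *\<^sub>R (norm c *\<^sub>R v - c) - (1 - \<theta>) *\<^sub>R c"
      using \<theta>(3) by (simp add: algebra_simps)
    then have "norm (\<rho> j *\<^sub>R v - c) \<le> norm (\<theta> *\<^sub>R (norm c *\<^sub>R v - c)) + norm ((1 - \<theta>) *\<^sub>R c)"
      by (metis norm_triangle_ineq4)
    also have "\<dots> = \<theta> * norm (norm c *\<^sub>R v - c) + (1 - \<theta>) * norm c"
      using \<theta> by simp
    also have "\<dots> \<le> \<theta> * (norm c * \<sigma>) + (1 - \<theta>) * norm c"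
      using v \<theta> by (simp add: mult_left_mono)
    also have "\<dots> = \<rho> j * \<sigma> + (norm c - \<rho> j)"
      using \<theta>(3) by (metis left_diff_distrib mult.assoc mult.left_neutral)
    finally show ?thesis .
  qed
  also have "\<rho> j * \<sigma> \<le> \<beta> * \<sigma>" using j m \<open>0 \<le> \<sigma>\<close> by (intro mult_right_mono) auto
  finally show thesis using that[of j v] j m v by auto
qed

lemma step_controls_bounded:
  assumes u: "u \<in> step_controls p r a b \<Delta> N \<tau> q \<rho> S" and P: "uniform_partition a b \<Delta> N \<tau>" "0 < \<Delta>"
  shows "bounded (u ` {a..b})"
proof -
  obtain j v where jv: "\<And>i t. i < N \<Longrightarrow> t \<in> {\<tau> i..<\<tau> (Suc i)} \<Longrightarrow> u t = \<rho> (j i) *\<^sub>R v i"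
    using u by (auto simp: step_controls_def)
  \<comment> \<open>The cells are half-open, so the free value at \<open>b\<close> has to be added
    to the finitely many prescribed ones.\<close>
  have "u t \<in> insert (u b) ((\<lambda>i. \<rho> (j i) *\<^sub>R v i) ` {..<N})" if t: "t \<in> {a..b}" for t
  proof (cases "t = b")
    case False
    then obtain i where "i < N" "t \<in> {\<tau> i..<\<tau> (Suc i)}"
      using uniform_partition_cell[OF P, of t] t by auto
    then have "u t = \<rho> (j i) *\<^sub>R v i" by (rule jv)
    with \<open>i < N\<close> show ?thesis by blast
  qed auto
  then have "u ` {a..b} \<subseteq> insert (u b) ((\<lambda>i. \<rho> (j i) *\<^sub>R v i) ` {..<N})" by blast
  then show ?thesis by (rule bounded_subset[rotated]) (simp add: finite_imp_bounded)
qed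

text \<open>Off the finite grid the control is continuous, which lets the integral equation be
  differentiated there when trajectories are constructed.\<close>

lemma step_controls_continuous:
  assumes u: "u \<in> step_controls p r a b \<Delta> N \<tau> q \<rho> S" and P: "uniform_partition a b \<Delta> N \<tau>" "0 < \<Delta>"
    and t: "t \<in> {a..b} - \<tau> ` {..N}"
  shows "continuous (at t within T) u"
proof -
  obtain j v where jv: "\<And>i t. i < N \<Longrightarrow> t \<in> {\<tau> i..<\<tau> (Suc i)} \<Longrightarrow> u t = \<rho> (j i) *\<^sub>R v i"
    using u by (auto simp: step_controls_def)
  have "t \<noteq> b" using t P by (auto simp: uniform_partition_def)
  then obtain i where i: "i < N" "t \<in> {\<tau> i..<\<tau> (Suc i)}"
    using uniform_partition_cell[OF P, of t] t by auto
  then have "t \<in> {\<tau> i<..<\<tau> (Suc i)}" using t by (auto simp: order_less_le)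
  moreover have "continuous_on {\<tau> i<..<\<tau> (Suc i)} u"
    using jv[OF i(1)] by (subst continuous_on_cong[OF refl, of _ _ "\<lambda>_. \<rho> (j i) *\<^sub>R v i"]) auto
  ultimately have "isCont u t" by (simp add: continuous_on_eq_continuous_at)
  then show ?thesis by (rule continuous_at_imp_continuous_within)
qed

lemma step_integral:
  fixes h :: "real \<Rightarrow> real"
  assumes P: "uniform_partition a b \<Delta> N \<tau>" "0 < \<Delta>" and h: "h integrable_on {a..b}"
    and k: "\<And>i t. i < N \<Longrightarrow> t \<in> {\<tau> i..<\<tau> (Suc i)} \<Longrightarrow> h t = k i t"
  shows "integral {a..b} h = (\<Sum>i<N. integral {\<tau> i..\<tau> (Suc i)} (k i))"
  unfolding uniform_partition_sum_integral[OF P h, symmetric]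
proof (intro sum.cong refl)
  fix i assume "i \<in> {..<N}"
  then show "integral {\<tau> i..\<tau> (Suc i)} h = integral {\<tau> i..\<tau> (Suc i)} (k i)"
    using k[of i] by (intro integral_spike[of "{\<tau> (Suc i)}"]) auto
qed

lemma step_controls_subset_Lp_ball:
  assumes P: "uniform_partition a b \<Delta> N \<tau>" "0 < \<Delta>" and R: "uniform_partition 0 \<beta> \<delta> q \<rho>" "0 < \<delta>"
    and S: "S \<subseteq> sphere 0 1" and p: "1 < p" "0 < r"
  shows "step_controls p r a b \<Delta> N \<tau> q \<rho> S \<subseteq> Lp_ball p r a b"
proof
  fix u assume u: "u \<in> step_controls p r a b \<Delta> N \<tau> q \<rho> S"
  then obtain j v where jv: "\<And>i. i < N \<Longrightarrow> j i \<le> q" "\<And>i. i < N \<Longrightarrow> v i \<in> S"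
     "\<And>i t. i < N \<Longrightarrow> t \<in> {\<tau> i..<\<tau> (Suc i)} \<Longrightarrow> u t = \<rho> (j i) *\<^sub>R v i"
    and le: "\<Delta> * (\<Sum>i<N. \<rho> (j i) powr p) \<le> r powr p" and uL: "u \<in> Lp_space p a b"
    unfolding step_controls_def by blast
  have int: "integrable (lebesgue_on {a..b}) (\<lambda>s. norm (u s) powr p)"
    using uL by (auto simp: Lp_space_def)
  have "(LINT s|lebesgue_on {a..b}. norm (u s) powr p) = integral {a..b} (\<lambda>s. norm (u s) powr p)"
    using int by (simp add: lebesgue_integral_eq_integral)
  also have "\<dots> = (\<Sum>i<N. integral {\<tau> i..\<tau> (Suc i)} (\<lambda>_. \<rho> (j i) powr p))"
  proof (rule step_integral[OF P])
    show "(\<lambda>s. norm (u s) powr p) integrable_on {a..b}" by (intro integrable_on_lebesgue_on int) auto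
    fix i t assume i: "i < N" "t \<in> {\<tau> i..<\<tau> (Suc i)}"
    have "0 \<le> \<rho> (j i)" using uniform_partition_nth[OF R(1) jv(1)[OF i(1)]] R(2) by simp
    then show "norm (u t) powr p = \<rho> (j i) powr p" using jv(2,3)[OF i(1)] i S by auto
  qed
  also have "\<dots> = (\<Sum>i<N. \<Delta> * \<rho> (j i) powr p)"
  proof (intro sum.cong refl)
    fix i assume "i \<in> {..<N}"
    then show "integral {\<tau> i..\<tau> (Suc i)} (\<lambda>_. \<rho> (j i) powr p) = \<Delta> * \<rho> (j i) powr p"
      using uniform_partition_bounds[OF P, of i] by simp
  qed
  also have "\<dots> \<le> r powr p" using le by (simp add: sum_distrib_left)
  finally have "Lp_norm p a b u \<le> (r powr p) powr (1 / p)"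
    unfolding Lp_norm_def using p by (intro powr_mono2) (auto intro!: integral_nonneg_AE)
  then show "u \<in> Lp_ball p r a b" using uL p by (simp add: Lp_ball_def powr_powr)
qed

text \<open>Three errors add up: averaging, rounding by \<open>\<delta> + \<beta> * \<sigma>\<close>
  per unit of time, and capping radii at \<open>\<beta>\<close>. The capping errors of the cells sum
  to the last term because Jensen gives
  \<open>(\<Sum>i<N. \<Delta> * norm (A i) powr p) \<le> r powr p\<close>. Only the averaging error
  depends on more than the norm of \<open>u\<close>, so it is kept as it stands.\<close>

lemma step_control_approximation:
  fixes u :: "real \<Rightarrow> 'a::euclidean_space"
  assumes u: "u \<in> Lp_ball p r a b" and p: "1 < p" "0 < r"
    and P: "uniform_partition a b \<Delta> N \<tau>" "0 < \<Delta>" and R: "uniform_partition 0 \<beta> \<delta> q \<rho>" "0 < \<delta>" "0 < \<beta>"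
    and S: "sphere_net \<sigma> S" "0 \<le> \<sigma>"
  obtains v where "v \<in> step_controls p r a b \<Delta> N \<tau> q \<rho> S"
    "integral {a..b} (\<lambda>s. norm (u s - v s)) \<le>
      (\<Sum>i<N. integral {\<tau> i..\<tau> (Suc i)} (\<lambda>s. norm (u s - (1 / \<Delta>) *\<^sub>R integral {\<tau> i..\<tau> (Suc i)} u)))
      + (b - a) * (\<delta> + \<beta> * \<sigma>) + r powr p / \<beta> powr (p - 1)"
proof -
  define A where "A i = (1 / \<Delta>) *\<^sub>R integral {\<tau> i..\<tau> (Suc i)} u" for i
  define good where "good i j v \<longleftrightarrow> j \<le> q \<and> v \<in> S \<and> 0 \<le> \<rho> j \<and> \<rho> j \<le> norm (A i) \<and>
    norm (\<rho> j *\<^sub>R v - A i) \<le> \<delta> + \<beta> * \<sigma> + norm (A i) powr p / \<beta> powr (p - 1)" for i j v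
  have "\<exists>j v. good i j v" for i
    using p by (rule_tac round_to_grid[OF R S, of p "A i"]) (auto simp: good_def)
  then obtain j w where "\<And>i. good i (j i) (w i)" by metis
  then have j: "\<And>i. j i \<le> q" "\<And>i. w i \<in> S" "\<And>i. 0 \<le> \<rho> (j i)" "\<And>i. \<rho> (j i) \<le> norm (A i)"
    and jA: "\<And>i. norm (\<rho> (j i) *\<^sub>R w i - A i) \<le> \<delta> + \<beta> * \<sigma> + norm (A i) powr p / \<beta> powr (p - 1)"
    by (auto simp: good_def)
  \<comment> \<open>As a sum of indicators \<open>v\<close> is visibly measurable; at
    \<open>b\<close> and outside the interval it is 0.\<close>
  define v where "v t = (\<Sum>i<N. indicator {\<tau> i..<\<tau> (Suc i)} t *\<^sub>R (\<rho> (j i) *\<^sub>R w i))" for t :: real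
  have v: "v t = \<rho> (j i) *\<^sub>R w i" if i: "i < N" "t \<in> {\<tau> i..<\<tau> (Suc i)}" for i t
  proof -
    have "v t = (\<Sum>k<N. if k = i then \<rho> (j i) *\<^sub>R w i else 0)"
      unfolding v_def
    proof (intro sum.cong refl)
      fix k assume "k \<in> {..<N}"
      then have "t \<in> {\<tau> k..<\<tau> (Suc k)} \<longleftrightarrow> k = i"
        using uniform_partition_cell_unique[OF P, of k i t] i by blast
      then show "indicat_real {\<tau> k..<\<tau> (Suc k)} t *\<^sub>R \<rho> (j k) *\<^sub>R w k = (if k = i then \<rho> (j i) *\<^sub>R w i else 0)"
        by (simp add: indicator_def)
    qed
    then show ?thesis using i by simp
  qed
  have uint: "integrable (lebesgue_on {a..b}) u"
    using Lp_space_integrable[of u p a b] u p by (auto simp: Lp_ball_def)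
  note up = Lp_ball_integrable_powr[OF u]
  have ui: "u absolutely_integrable_on {\<tau> i..\<tau> (Suc i)}"
    and upi: "(\<lambda>s. norm (u s) powr p) integrable_on {\<tau> i..\<tau> (Suc i)}" if "i < N" for i
    using uniform_partition_bounds[OF P that] p
    by (auto intro!: integrable_lebesgue_on_absolutely[OF uint] integrable_subinterval_real[OF up(1)])
  have "(\<Sum>i<N. \<Delta> * norm (A i) powr p) \<le> (\<Sum>i<N. integral {\<tau> i..\<tau> (Suc i)} (\<lambda>s. norm (u s) powr p))"
  proof (intro sum_mono)
    fix i assume "i \<in> {..<N}"
    then have i: "i < N" by simp
    note b = uniform_partition_bounds[OF P this]
    show "\<Delta> * norm (A i) powr p \<le> integral {\<tau> i..\<tau> (Suc i)} (\<lambda>s. norm (u s) powr p)"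
      using average_powr_le[OF ui[OF i] upi[OF i] b(2) p(1)] unfolding A_def b(4) .
  qed
  also have "\<dots> = integral {a..b} (\<lambda>s. norm (u s) powr p)"
    using up p by (intro uniform_partition_sum_integral[OF P]) auto
  also have "\<dots> \<le> r powr p" using up p by auto
  finally have Ap: "(\<Sum>i<N. \<Delta> * norm (A i) powr p) \<le> r powr p" .
  have vm: "v \<in> borel_measurable (lebesgue_on {a..b})"
    unfolding v_def
    by (intro measurable_restrict_space1 borel_measurable_sum borel_measurable_scaleR
        borel_measurable_indicator borel_measurable_const) auto
  show thesis
  proof
    have "integrable (lebesgue_on {a..b}) (\<lambda>s. norm (v s) powr p)"
    proof (rule finite_measure.integrable_const_bound)
      show "finite_measure (lebesgue_on {a..b})" by (intro finite_measure_lebesgue_on) auto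
      show "AE s in lebesgue_on {a..b}. norm (norm (v s) powr p) \<le> (\<Sum>i<N. norm (\<rho> (j i) *\<^sub>R w i)) powr p"
        using p unfolding v_def
        by (intro AE_I2) (auto intro!: powr_mono2 sum_norm_le simp: indicator_def)
    qed (use vm in measurable)
    moreover have "\<Delta> * (\<Sum>i<N. \<rho> (j i) powr p) \<le> r powr p"
    proof -
      have "(\<Sum>i<N. \<Delta> * \<rho> (j i) powr p) \<le> (\<Sum>i<N. \<Delta> * norm (A i) powr p)"
        using j P p by (intro sum_mono mult_left_mono powr_mono2) auto
      then show ?thesis using Ap by (simp add: sum_distrib_left)
    qed
    ultimately show v_step: "v \<in> step_controls p r a b \<Delta> N \<tau> q \<rho> S"
      using vm v j unfolding step_controls_def Lp_space_def by blast
    then have "integrable (lebesgue_on {a..b}) (\<lambda>s. norm (u s - v s))"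
      using uint Lp_space_integrable[of v p a b] p by (auto simp: step_controls_def)
    then have "(\<lambda>s. norm (u s - v s)) integrable_on {a..b}" by (intro integrable_on_lebesgue_on) auto
    then have "integral {a..b} (\<lambda>s. norm (u s - v s)) = (\<Sum>i<N. integral {\<tau> i..\<tau> (Suc i)} (\<lambda>s. norm (u s - \<rho> (j i) *\<^sub>R w i)))"
      by (rule step_integral[OF P]) (simp add: v)
    also have "\<dots> \<le> (\<Sum>i<N. integral {\<tau> i..\<tau> (Suc i)} (\<lambda>s. norm (u s - A i))
        + (\<Delta> * (\<delta> + \<beta> * \<sigma>) + \<Delta> * norm (A i) powr p / \<beta> powr (p - 1)))"
    proof (intro sum_mono)
      fix i assume "i \<in> {..<N}"
      then have i: "i < N" by simp
      note b = uniform_partition_bounds[OF P this]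
      note int = absolutely_integrable_norm_diff_const[OF ui[OF i]]
      let ?c = "\<delta> + \<beta> * \<sigma> + norm (A i) powr p / \<beta> powr (p - 1)"
      have "integral {\<tau> i..\<tau> (Suc i)} (\<lambda>s. norm (u s - \<rho> (j i) *\<^sub>R w i)) \<le>
        integral {\<tau> i..\<tau> (Suc i)} (\<lambda>s. norm (u s - A i) + ?c)"
      proof (intro integral_le int integrable_add)
        fix s
        show "norm (u s - \<rho> (j i) *\<^sub>R w i) \<le> norm (u s - A i) + ?c"
          using norm_triangle_ineq4[of "u s - A i" "\<rho> (j i) *\<^sub>R w i - A i"] jA[of i] by simp
      qed auto
      also have "\<dots> = integral {\<tau> i..\<tau> (Suc i)} (\<lambda>s. norm (u s - A i)) + \<Delta> * ?c"
        using int b by (subst integral_add) auto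
      finally show "integral {\<tau> i..\<tau> (Suc i)} (\<lambda>s. norm (u s - \<rho> (j i) *\<^sub>R w i)) \<le>
        integral {\<tau> i..\<tau> (Suc i)} (\<lambda>s. norm (u s - A i)) + (\<Delta> * (\<delta> + \<beta> * \<sigma>) + \<Delta> * norm (A i) powr p / \<beta> powr (p - 1))"
        by (simp add: algebra_simps)
    qed
    also have "\<dots> = (\<Sum>i<N. integral {\<tau> i..\<tau> (Suc i)} (\<lambda>s. norm (u s - A i)))
        + (real N * \<Delta> * (\<delta> + \<beta> * \<sigma>) + (\<Sum>i<N. \<Delta> * norm (A i) powr p) / \<beta> powr (p - 1))"
      by (simp add: sum.distrib sum_divide_distrib)
    also have "real N * \<Delta> = b - a" using uniform_partition_end[OF P(1)] by simp
    also have "(\<Sum>i<N. \<Delta> * norm (A i) powr p) / \<beta> powr (p - 1) \<le> r powr p / \<beta> powr (p - 1)"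
      using Ap by (simp add: divide_right_mono)
    finally show "integral {a..b} (\<lambda>s. norm (u s - v s)) \<le>
      (\<Sum>i<N. integral {\<tau> i..\<tau> (Suc i)} (\<lambda>s. norm (u s - (1 / \<Delta>) *\<^sub>R integral {\<tau> i..\<tau> (Suc i)} u)))
      + (b - a) * (\<delta> + \<beta> * \<sigma>) + r powr p / \<beta> powr (p - 1)"
      by (simp add: A_def)
  qed
qed

section \<open>Existence of trajectories\<close>

text \<open>Measured with the weight \<open>exp (2 * L * (t - a))\<close> (a Bielecki norm), the
  Picard operator contracts by 1/2 on the whole interval, so the iteration converges globally at
  once. Integrability along continuous curves takes the place of continuity in time, since
  \<open>g\<close> will contain a step control.\<close>

lemma Picard_global:
  fixes g :: "real \<Rightarrow> 'a::euclidean_space \<Rightarrow> 'a"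
  assumes "a \<le> b" and "0 < L"
    and int: "\<And>x. continuous_on {a..b} x \<Longrightarrow> (\<lambda>s. g s (x s)) integrable_on {a..b}"
    and lip: "\<And>s x y. s \<in> {a..b} \<Longrightarrow> norm (g s x - g s y) \<le> L * norm (x - y)"
  obtains x where "continuous_on {a..b} x"
    "\<And>t. t \<in> {a..b} \<Longrightarrow> x t = x0 + integral {a..t} (\<lambda>s. g s (x s))"
proof -
  define T where "T x t = x0 + integral {a..t} (\<lambda>s. g s (x s))" for x t
  define X where "X n = (T ^^ n) (\<lambda>_. x0)" for n
  have X0: "X 0 = (\<lambda>_. x0)" and XS: "X (Suc n) = T (X n)" for n by (auto simp: X_def)
  have Tcont: "continuous_on {a..b} (T x)" if "continuous_on {a..b} x" for x
    unfolding T_def by (intro continuous_intros indefinite_integral_continuous_1 int that)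
  have Xcont: "continuous_on {a..b} (X n)" for n
    by (induction n) (auto simp: X0 XS Tcont)
  have T_diff: "norm (T x t - T y t) \<le> integral {a..t} h"
    if "continuous_on {a..b} x" "continuous_on {a..b} y" "t \<in> {a..b}" "h integrable_on {a..t}"
      "\<And>s. s \<in> {a..t} \<Longrightarrow> L * norm (x s - y s) \<le> h s" for x y t h
  proof -
    have gi: "(\<lambda>s. g s (x s)) integrable_on {a..t}" "(\<lambda>s. g s (y s)) integrable_on {a..t}"
      using that(3) by (auto intro!: integrable_subinterval_real[OF int] that)
    have "T x t - T y t = integral {a..t} (\<lambda>s. g s (x s) - g s (y s))"
      using gi by (subst integral_diff) (auto simp: T_def)
    also have "norm \<dots> \<le> integral {a..t} h"
    proof (intro integral_norm_bound_integral integrable_diff gi that(4))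
      fix s assume s: "s \<in> {a..t}"
      then show "norm (g s (x s) - g s (y s)) \<le> h s"
        using lip[of s "x s" "y s"] that(3) that(5)[OF s] by auto
    qed
    finally show ?thesis .
  qed
  have "bounded ((\<lambda>t. X 1 t - X 0 t) ` {a..b})"
    by (intro compact_imp_bounded compact_continuous_image continuous_intros Xcont) auto
  then obtain C where "0 < C" and C: "\<And>t. t \<in> {a..b} \<Longrightarrow> norm (X 1 t - X 0 t) \<le> C"
    unfolding bounded_pos by auto
  \<comment> \<open>The 2 in the exponent produces the contraction factor 1/2 on
    integration.\<close>
  have exp_int: "((\<lambda>s. L * exp (2 * L * (s - a))) has_integral (exp (2 * L * (t - a)) - 1) / 2) {a..t}"
    if "a \<le> t" for t
  proof -
    have "((\<lambda>s. L * exp (2 * L * (s - a))) has_integral exp (2 * L * (t - a)) / 2 - exp (2 * L * (a - a)) / 2) {a..t}"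
      using that by (intro fundamental_theorem_of_calculus)
        (auto intro!: derivative_eq_intros simp flip: has_real_derivative_iff_has_vector_derivative)
    then show ?thesis by (simp add: diff_divide_distrib)
  qed
  have bound: "norm (X (Suc n) t - X n t) \<le> C * (1/2)^n * exp (2 * L * (t - a))" if "t \<in> {a..b}" for n t
    using that
  proof (induction n arbitrary: t)
    case 0
    have "C * 1 \<le> C * exp (2 * L * (t - a))" using \<open>0 < C\<close> \<open>0 < L\<close> 0 by (intro mult_left_mono) auto
    then show ?case using C[OF 0] by simp
  next
    case (Suc n)
    have E: "((\<lambda>s. C * (1/2)^n * (L * exp (2 * L * (s - a)))) has_integral
        C * (1/2)^n * ((exp (2 * L * (t - a)) - 1) / 2)) {a..t}"
      using Suc.prems by (intro has_integral_mult_right exp_int) auto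
    have "norm (X (Suc (Suc n)) t - X (Suc n) t) \<le> integral {a..t} (\<lambda>s. C * (1/2)^n * (L * exp (2 * L * (s - a))))"
      unfolding XS[of "Suc n"] XS[of n, symmetric]
      unfolding XS[of n]
    proof (rule T_diff[OF _ Xcont Suc.prems has_integral_integrable[OF E]])
      fix s assume "s \<in> {a..t}"
      then have "L * norm (X (Suc n) s - X n s) \<le> L * (C * (1/2)^n * exp (2 * L * (s - a)))"
        using Suc.IH[of s] Suc.prems \<open>0 < L\<close> by (intro mult_left_mono) auto
      then show "L * norm (T (X n) s - X n s) \<le> C * (1/2)^n * (L * exp (2 * L * (s - a)))"
        by (simp add: XS mult_ac)
    qed (use Xcont Tcont in blast)
    also have "\<dots> = C * (1/2)^n * ((exp (2 * L * (t - a)) - 1) / 2)" using E by (rule integral_unique)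
    also have "\<dots> \<le> C * (1/2)^n * (exp (2 * L * (t - a)) / 2)"
      using \<open>0 < C\<close> by (intro mult_left_mono) auto
    finally show ?case by simp
  qed
  have "uniform_limit {a..b} (\<lambda>n t. \<Sum>i<n. X (Suc i) t - X i t) (\<lambda>t. suminf (\<lambda>i. X (Suc i) t - X i t)) sequentially"
  proof (rule Weierstrass_m_test)
    show "summable (\<lambda>n. C * (1/2)^n * exp (2 * L * (b - a)))"
      by (intro summable_mult2 summable_mult summable_geometric) auto
    fix n t assume t: "t \<in> {a..b}"
    have "C * (1/2)^n * exp (2 * L * (t - a)) \<le> C * (1/2)^n * exp (2 * L * (b - a))"
      using t \<open>0 < C\<close> \<open>0 < L\<close> by (intro mult_left_mono) auto
    then show "norm (X (Suc n) t - X n t) \<le> C * (1/2)^n * exp (2 * L * (b - a))"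
      using bound[OF t, of n] by linarith
  qed
  then have "uniform_limit {a..b} (\<lambda>n t. x0 + (\<Sum>i<n. X (Suc i) t - X i t)) (\<lambda>t. x0 + suminf (\<lambda>i. X (Suc i) t - X i t)) sequentially"
    by (intro uniform_limit_intros)
  moreover have "x0 + (\<Sum>i<n. X (Suc i) t - X i t) = X n t" for n t
    using sum_lessThan_telescope[of "\<lambda>i. X i t" n] by (simp add: X0)
  ultimately obtain x where lim: "uniform_limit {a..b} X x sequentially" by auto
  have xcont: "continuous_on {a..b} x"
    by (rule uniform_limit_theorem[OF _ lim]) (auto simp: Xcont)
  have "x t = T x t" if t: "t \<in> {a..b}" for t
  proof -
    have 1: "(\<lambda>n. X n t) \<longlonglongrightarrow> x t" using tendsto_uniform_limitI[OF lim t] .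
    have "(\<lambda>n. X (Suc n) t) \<longlonglongrightarrow> T x t"
      unfolding XS tendsto_iff
    proof (intro allI impI)
      fix e :: real assume "e > 0"
      \<comment> \<open>The \<open>+ 1\<close> keeps the denominator positive when
        \<open>a = b\<close>.\<close>
      define e1 where "e1 = e / (2 * L * (b - a + 1))"
      have e1: "e1 > 0" "L * e1 * (t - a) < e"
      proof -
        show "e1 > 0" using \<open>e > 0\<close> \<open>0 < L\<close> \<open>a \<le> b\<close> by (simp add: e1_def)
        have "L * e1 * (t - a) \<le> L * e1 * (b - a + 1)"
          using t \<open>e1 > 0\<close> \<open>0 < L\<close> by (intro mult_left_mono) auto
        also have "\<dots> = e / 2"
        proof -
          have "L * (e / (2 * L * B)) * B = e / 2" if "0 < B" for B
            using that \<open>0 < L\<close> by simp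
          then show ?thesis using \<open>a \<le> b\<close> unfolding e1_def by simp
        qed
        finally show "L * e1 * (t - a) < e" using \<open>e > 0\<close> by simp
      qed
      have "\<forall>\<^sub>F n in sequentially. \<forall>s\<in>{a..b}. dist (X n s) (x s) < e1"
        using uniform_limitD[OF lim e1(1)] .
      then show "\<forall>\<^sub>F n in sequentially. dist (T (X n) t) (T x t) < e"
      proof eventually_elim
        case (elim n)
        have "norm (T (X n) t - T x t) \<le> integral {a..t} (\<lambda>s. L * e1)"
        proof (rule T_diff[OF Xcont xcont t])
          fix s assume "s \<in> {a..t}"
          then have "dist (X n s) (x s) < e1" using elim t by auto
          then show "L * norm (X n s - x s) \<le> L * e1" using \<open>0 < L\<close> by (simp add: dist_norm)
        qed auto
        also have "\<dots> = L * e1 * (t - a)" using t by simp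
        finally show ?case using e1(2) by (simp add: dist_norm)
      qed
    qed
    with LIMSEQ_Suc[OF 1] show ?thesis by (rule LIMSEQ_unique)
  qed
  then show thesis using that[OF xcont] by (auto simp: T_def)
qed

lemma Lipschitz_imp_abs_continuous:
  assumes lip: "\<And>s t. a \<le> s \<Longrightarrow> s \<le> t \<Longrightarrow> t \<le> b \<Longrightarrow> dist (x t) (x s) \<le> M * (t - s)"
  shows "abs_continuous_on_interval a b x"
  unfolding abs_continuous_on_interval_def
proof (intro allI impI)
  fix e :: real assume "0 < e"
  \<comment> \<open>\<open>M\<close> may be zero or negative, while the witness
    \<open>e / M'\<close> has to be positive.\<close>
  define M' where "M' = max M 1"
  have M': "0 < M'" "M \<le> M'" by (auto simp: M'_def)
  have "(\<Sum>i<k. dist (x (r i)) (x (l i))) < e"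
    if lr: "\<forall>i<k. a \<le> l i \<and> l i \<le> r i \<and> r i \<le> b" "(\<Sum>i<k. r i - l i) < e / M'" for k :: nat and l r
  proof -
    have "(\<Sum>i<k. dist (x (r i)) (x (l i))) \<le> (\<Sum>i<k. M' * (r i - l i))"
    proof (intro sum_mono)
      fix i assume "i \<in> {..<k}"
      then have i: "a \<le> l i" "l i \<le> r i" "r i \<le> b" using lr by auto
      then have "M * (r i - l i) \<le> M' * (r i - l i)" using M' by (intro mult_right_mono) auto
      then show "dist (x (r i)) (x (l i)) \<le> M' * (r i - l i)" using lip[OF i] by simp
    qed
    also have "\<dots> = M' * (\<Sum>i<k. r i - l i)" by (simp add: sum_distrib_left)
    also have "\<dots> < e" using lr(2) M' by (simp add: field_simps)
    finally show ?thesis .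
  qed
  then show "\<exists>\<delta>>0. \<forall>(k::nat) l r. (\<forall>i<k. a \<le> l i \<and> l i \<le> r i \<and> r i \<le> b) \<and>
      disjoint_family_on (\<lambda>i. {l i<..<r i}) {..<k} \<and> (\<Sum>i<k. r i - l i) < \<delta> \<longrightarrow>
      (\<Sum>i<k. dist (x (r i)) (x (l i))) < e"
    using \<open>0 < e\<close> M' by (intro exI[of _ "e / M'"]) auto
qed

text \<open>The Lipschitz condition holds only on bounded sets, so the state is first projected onto
  a ball of radius \<open>R\<close>, which makes the right-hand side globally Lipschitz because
  \<open>u\<close> is bounded. Projection does not increase norms, so the truncated equation obeys
  the same growth bound; its solution stays in the ball and solves the original equation.\<close>

lemma trajectory_exists:
  fixes f :: "real \<Rightarrow> 'x::euclidean_space \<Rightarrow> 'u::euclidean_space \<Rightarrow> 'x"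
  assumes "a \<le> b"
    and cont: "continuous_on ({a..b} \<times> UNIV \<times> UNIV) (\<lambda>(t, x, u). f t x u)"
    and lip: "\<And>D. D \<subseteq> {a..b} \<times> UNIV \<Longrightarrow> bounded D \<Longrightarrow>
      \<exists>\<gamma>1>0. \<exists>\<gamma>2>0. \<exists>\<gamma>3>0. \<forall>t x1 x2 u1 u2. (t, x1) \<in> D \<and> (t, x2) \<in> D \<longrightarrow>
        norm (f t x1 u1 - f t x2 u2)
          \<le> (\<gamma>1 + \<gamma>2 * (norm u1 + norm u2)) * norm (x1 - x2) + \<gamma>3 * norm (u1 - u2)"
    and "0 < c" and growth: "\<And>t x u. t \<in> {a..b} \<Longrightarrow> norm (f t x u) \<le> c * (norm x + 1) * (norm u + 1)"
    and um: "u \<in> borel_measurable (lebesgue_on {a..b})" and ub: "bounded (u ` {a..b})"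
    and "finite Z" and ucont: "\<And>t. t \<in> {a..b} - Z \<Longrightarrow> continuous (at t within {a..b}) u"
  obtains x where "trajectory f a b x0 u x"
proof -
  obtain \<beta> where "0 < \<beta>" and \<beta>: "\<And>t. t \<in> {a..b} \<Longrightarrow> norm (u t) \<le> \<beta>"
    using ub unfolding bounded_pos by auto
  define k where "k = c * (\<beta> + 1)"
  have "0 < k" using \<open>0 < c\<close> \<open>0 < \<beta>\<close> by (simp add: k_def)
  \<comment> \<open>The a priori bound of \<open>linear_growth_bound\<close> for the constant kernel
    \<open>k\<close>.\<close>
  define R where "R = (norm x0 + 1) * exp (2 * (k * (b - a)))"
  have "0 < R" by (simp add: R_def add_nonneg_pos)
  define P where "P = closest_point (cball (0::'x) R)"
  have Pdist: "norm (P x - P y) \<le> norm (x - y)" for x y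
    unfolding P_def using \<open>0 < R\<close> closest_point_lipschitz[of "cball (0::'x) R" x y] by (simp add: dist_norm)
  have Pself: "P x = x" if "norm x \<le> R" for x
    unfolding P_def using that by (intro closest_point_self) auto
  have Pbound: "norm (P x) \<le> R" for x
    unfolding P_def using closest_point_in_set[of "cball (0::'x) R" x] \<open>0 < R\<close> by auto
  have Pnorm: "norm (P x) \<le> norm x" for x
    using Pdist[of x 0] Pself[of 0] \<open>0 < R\<close> by simp
  have Pcont: "continuous_on UNIV P"
    unfolding P_def using \<open>0 < R\<close> by (intro continuous_on_closest_point) auto
  have "bounded ({a..b} \<times> cball (0::'x) R)" "{a..b} \<times> cball (0::'x) R \<subseteq> {a..b} \<times> UNIV"
    by (auto intro: bounded_Times)
  from lip[OF this(2,1)] obtain \<gamma>1 \<gamma>2 \<gamma>3 where "0 < \<gamma>1" "0 < \<gamma>2" and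
    \<gamma>: "\<And>t x1 x2 u1 u2. (t, x1) \<in> {a..b} \<times> cball 0 R \<Longrightarrow> (t, x2) \<in> {a..b} \<times> cball 0 R \<Longrightarrow>
      norm (f t x1 u1 - f t x2 u2) \<le> (\<gamma>1 + \<gamma>2 * (norm u1 + norm u2)) * norm (x1 - x2) + \<gamma>3 * norm (u1 - u2)"
    by blast
  \<comment> \<open>Clamping time to the interval extends \<open>f\<close> continuously to the whole
    space, so that composing it with measurable functions is immediate.\<close>
  define F where "F = (\<lambda>(t, x, u). f (max a (min b t)) x u)"
  have Fcont: "continuous_on UNIV F"
  proof -
    have "continuous_on UNIV (\<lambda>z::real \<times> 'x \<times> 'u. (max a (min b (fst z)), fst (snd z), snd (snd z)))"
      by (intro continuous_intros)
    from continuous_on_compose2[OF cont this] \<open>a \<le> b\<close> show ?thesis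
      by (force simp: F_def case_prod_unfold)
  qed
  have Feq: "F (t, x, u) = f t x u" if "t \<in> {a..b}" for t x u using that by (simp add: F_def)
  define g where "g s x = F (s, P x, u s)" for s x
  have gbound: "norm (g s x) \<le> k * (norm (P x) + 1)" if "s \<in> {a..b}" for s x
  proof -
    have "norm (g s x) \<le> c * (norm (P x) + 1) * (norm (u s) + 1)"
      using growth that Feq by (simp add: g_def)
    also have "\<dots> \<le> c * (norm (P x) + 1) * (\<beta> + 1)"
      using \<beta>[OF that] \<open>0 < c\<close> by (intro mult_left_mono) auto
    finally show ?thesis by (simp add: k_def mult_ac)
  qed
  have gint: "(\<lambda>s. g s (x s)) integrable_on {a..b}" if x: "continuous_on {a..b} x" for x
  proof (intro integrable_on_lebesgue_on finite_measure.integrable_const_bound)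
    show "finite_measure (lebesgue_on {a..b})" by (intro finite_measure_lebesgue_on) auto
    have "norm (g s (x s)) \<le> k * (R + 1)" if "s \<in> {a..b}" for s
    proof -
      have "k * (norm (P (x s)) + 1) \<le> k * (R + 1)" using Pbound \<open>0 < k\<close> by simp
      then show ?thesis using gbound[OF that, of "x s"] by linarith
    qed
    then show "AE s in lebesgue_on {a..b}. norm (g s (x s)) \<le> k * (R + 1)"
      by (intro AE_I2) simp
    have xm: "x \<in> borel_measurable (lebesgue_on {a..b})"
      by (intro continuous_imp_measurable_on_sets_lebesgue x) auto
    have "(\<lambda>s. P (x s)) \<in> borel_measurable (lebesgue_on {a..b})"
      by (rule borel_measurable_continuous_on[OF Pcont xm])
    moreover have "(\<lambda>s. s) \<in> borel_measurable (lebesgue_on {a..b})"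
      by (intro continuous_imp_measurable_on_sets_lebesgue continuous_intros) auto
    ultimately have "(\<lambda>s. (s, P (x s), u s)) \<in> borel_measurable (lebesgue_on {a..b})"
      by (intro borel_measurable_Pair um)
    then show "(\<lambda>s. g s (x s)) \<in> borel_measurable (lebesgue_on {a..b})"
      unfolding g_def by (rule borel_measurable_continuous_on[OF Fcont])
  qed auto
  define L where "L = \<gamma>1 + \<gamma>2 * (\<beta> + \<beta>)"
  have "0 < L" using \<open>0 < \<gamma>1\<close> \<open>0 < \<gamma>2\<close> \<open>0 < \<beta>\<close> by (simp add: L_def add_pos_nonneg)
  have glip: "norm (g s x - g s y) \<le> L * norm (x - y)" if s: "s \<in> {a..b}" for s x y
  proof -
    have "norm (g s x - g s y) \<le> (\<gamma>1 + \<gamma>2 * (norm (u s) + norm (u s))) * norm (P x - P y)"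
      using \<gamma>[of s "P x" "P y" "u s" "u s"] s Pbound by (simp add: g_def Feq)
    also have "\<dots> \<le> L * norm (x - y)"
      unfolding L_def using \<beta>[OF s] \<open>0 < \<gamma>1\<close> \<open>0 < \<gamma>2\<close> Pdist \<open>0 < \<beta>\<close>
      by (intro mult_mono add_left_mono mult_left_mono add_mono) auto
    finally show ?thesis .
  qed
  obtain x where xcont: "continuous_on {a..b} x"
    and xT: "\<And>t. t \<in> {a..b} \<Longrightarrow> x t = x0 + integral {a..t} (\<lambda>s. g s (x s))"
    using Picard_global[OF \<open>a \<le> b\<close> \<open>0 < L\<close> gint glip, of x0] by blast
  note gx = gint[OF xcont]
  have xR: "norm (x t) \<le> R" if t: "t \<in> {a..b}" for t
  proof -
    have "norm (x t) + 1 \<le> (norm x0 + 1) * exp (2 * integral {a..b} (\<lambda>s. k))"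
    proof (rule linear_growth_bound[OF xcont _ _ _ _ t])
      fix s assume s: "s \<in> {a..b}"
      have "(\<lambda>s. g s (x s)) integrable_on {a..s}" using s by (intro integrable_subinterval_real[OF gx]) auto
      then show "((\<lambda>s. g s (x s)) has_integral x s - x0) {a..s}"
        using xT[OF s] by (simp add: has_integral_integral)
      have "k * (norm (P (x s)) + 1) \<le> k * (norm (x s) + 1)" using Pnorm \<open>0 < k\<close> by simp
      then show "norm (g s (x s)) \<le> k * (norm (x s) + 1)" using gbound[OF s, of "x s"] by linarith
    qed (use \<open>0 < k\<close> in auto)
    then show ?thesis using \<open>a \<le> b\<close> by (simp add: R_def mult.commute)
  qed
  define y where "y = restrict x {a..b}"
  have "trajectory f a b x0 u y"
    unfolding trajectory_def
  proof (intro conjI)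
    show "y \<in> extensional {a..b}" by (simp add: y_def)
    show "y a = x0" using \<open>a \<le> b\<close> xT[of a] by (simp add: y_def)
    show "abs_continuous_on_interval a b y"
    proof (rule Lipschitz_imp_abs_continuous)
      fix s t assume st: "a \<le> s" "s \<le> t" "t \<le> b"
      have "integral {a..s} (\<lambda>s. g s (x s)) + integral {s..t} (\<lambda>s. g s (x s)) = integral {a..t} (\<lambda>s. g s (x s))"
        using st by (intro Henstock_Kurzweil_Integration.integral_combine integrable_subinterval_real[OF gx]) auto
      then have "y t - y s = integral {s..t} (\<lambda>s. g s (x s))"
        using st xT[of s] xT[of t] by (simp add: y_def algebra_simps)
      also have "norm \<dots> \<le> integral {s..t} (\<lambda>_. k * (R + 1))"
      proof (intro integral_norm_bound_integral integrable_subinterval_real[OF gx])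
        fix s' assume "s' \<in> {s..t}"
        then have "norm (g s' (x s')) \<le> k * (norm (P (x s')) + 1)" using st by (intro gbound) auto
        also have "\<dots> \<le> k * (R + 1)" using Pbound \<open>0 < k\<close> by simp
        finally show "norm (g s' (x s')) \<le> k * (R + 1)" .
      qed (use st in auto)
      finally show "dist (y t) (y s) \<le> k * (R + 1) * (t - s)"
        using st by (simp add: dist_norm mult_ac)
    qed
    have der: "(y has_vector_derivative f t (y t) (u t)) (at t within {a..b})" if t: "t \<in> {a..b} - Z" for t
    proof -
      \<comment> \<open>Inside the ball the projection is the identity, so \<open>h\<close> is the
        integrand of the solved equation; at points of continuity of \<open>u\<close> it is
        continuous and the integral has derivative \<open>h t\<close>.\<close>
      define h where "h s = F (s, x s, u s)" for s
      have gh: "g s (x s) = h s" if "s \<in> {a..b}" for s using xR[OF that] by (simp add: g_def h_def Pself)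
      have hint: "h integrable_on {a..b}" using integrable_cong[of "{a..b}" "\<lambda>s. g s (x s)" h] gx gh by auto
      have "((\<lambda>s. (s, x s, u s)) \<longlongrightarrow> (t, x t, u t)) (at t within {a..b})"
        using ucont[OF t] t xcont
        by (intro tendsto_Pair tendsto_ident_at) (auto simp: continuous_within continuous_on_def)
      moreover have "isCont F (t, x t, u t)" using Fcont by (simp add: continuous_on_eq_continuous_at)
      ultimately have "continuous (at t within {a..b}) h"
        unfolding h_def by (subst continuous_within) (rule isCont_tendsto_compose)
      then have "((\<lambda>s. integral {a..s} h) has_vector_derivative h t) (at t within {a..b})"
        using integral_has_vector_derivative_continuous_at[OF hint, of t "{}"] t by simp
      then have "((\<lambda>s. x0 + integral {a..s} h) has_vector_derivative h t) (at t within {a..b})"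
        by (auto intro!: derivative_eq_intros)
      then have "(y has_vector_derivative h t) (at t within {a..b})"
      proof (rule has_vector_derivative_transform[rotated -1])
        fix s assume s: "s \<in> {a..b}"
        then show "y s = x0 + integral {a..s} h"
          using gh xT[OF s] by (simp add: y_def) (intro integral_cong, auto)
      qed (use t in auto)
      then show ?thesis using t by (simp add: h_def Feq y_def)
    qed
    show "AE t in lebesgue_on {a..b}. (y has_vector_derivative f t (y t) (u t)) (at t within {a..b})"
    proof (rule AE_I')
      have "negligible (Z \<inter> {a..b})" using \<open>finite Z\<close> by (intro negligible_finite) auto
      then show "Z \<inter> {a..b} \<in> null_sets (lebesgue_on {a..b})"
        by (simp add: null_sets_restrict_space negligible_iff_null_sets)
    qed (use der in auto)
  qed
  then show thesis by (rule that)
qed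

section \<open>Compactness and stability of the set of trajectories\<close>

text \<open>The total boundedness half of Arzela-Ascoli. Functions are sampled at finitely many
  points and the samples rounded to a finite set; two functions with the same code differ by at most
  four times \<open>e / 4\<close>. One representative per code is taken from \<open>X\<close>
  itself, so that the net consists of members of \<open>X\<close>.\<close>

lemma finite_net_equicontinuous:
  fixes X :: "('a::metric_space \<Rightarrow> 'b::euclidean_space) set"
  assumes S: "compact S" and R: "\<And>x t. x \<in> X \<Longrightarrow> t \<in> S \<Longrightarrow> norm (x t) \<le> R"
    and eq: "\<And>e. e > 0 \<Longrightarrow> \<exists>d>0. \<forall>x\<in>X. \<forall>s\<in>S. \<forall>t\<in>S. dist s t < d \<longrightarrow> dist (x s) (x t) < e"
    and "e > 0"
  obtains Y where "finite Y" "Y \<subseteq> X" "\<And>x. x \<in> X \<Longrightarrow> \<exists>y\<in>Y. \<forall>t\<in>S. dist (x t) (y t) \<le> e"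
proof -
  obtain d where "d > 0" and d: "\<And>x s t. x \<in> X \<Longrightarrow> s \<in> S \<Longrightarrow> t \<in> S \<Longrightarrow> dist s t < d \<Longrightarrow> dist (x s) (x t) < e / 4"
    using eq[of "e/4"] \<open>e > 0\<close> by auto
  obtain T where T: "finite T" "T \<subseteq> S" "S \<subseteq> (\<Union>t\<in>T. ball t d)"
    using compactE_image[OF S, of S "\<lambda>t. ball t d"] \<open>d > 0\<close> by (metis UN_I centre_in_ball open_ball subsetI)
  obtain F where F: "finite F" "cball (0::'b) R \<subseteq> (\<Union>c\<in>F. ball c (e/4))"
  proof (rule compactE_image[of "cball (0::'b) R" "cball 0 R" "\<lambda>c. ball c (e/4)"])
    show "cball (0::'b) R \<subseteq> (\<Union>c\<in>cball 0 R. ball c (e/4))" using \<open>e > 0\<close> by force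
  qed auto
  \<comment> \<open>The restriction to \<open>T\<close> puts the codes into a finite extensional
    function space.\<close>
  define \<phi> where "\<phi> x = (\<lambda>t\<in>T. SOME c. c \<in> F \<and> dist (x t) c < e / 4)" for x :: "'a \<Rightarrow> 'b"
  have \<phi>: "\<phi> x t \<in> F \<and> dist (x t) (\<phi> x t) < e / 4" if "x \<in> X" "t \<in> T" for x t
  proof -
    have "x t \<in> cball 0 R" using R that T by auto
    then have "\<exists>c. c \<in> F \<and> dist (x t) c < e / 4" using F by (fastforce simp: dist_commute)
    then show ?thesis using someI_ex that(2) unfolding \<phi>_def by simp
  qed
  then have "\<phi> ` X \<subseteq> (\<Pi>\<^sub>E t\<in>T. F)" by (auto simp: \<phi>_def)
  then have fin: "finite (\<phi> ` X)" using finite_PiE[OF T(1)] F(1) by (meson finite_subset)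
  define Y where "Y = inv_into X \<phi> ` \<phi> ` X"
  show thesis
  proof
    show "finite Y" using fin by (simp add: Y_def)
    show "Y \<subseteq> X" by (auto simp: Y_def inv_into_into)
    fix x assume x: "x \<in> X"
    define y where "y = inv_into X \<phi> (\<phi> x)"
    have y: "y \<in> X" "\<phi> y = \<phi> x" "y \<in> Y"
      using x by (auto simp: y_def Y_def inv_into_into f_inv_into_f)
    have "dist (x t) (y t) \<le> e" if t: "t \<in> S" for t
    proof -
      obtain t' where t': "t' \<in> T" "dist t t' < d" using T(3) t by (auto simp: dist_commute)
      then have "dist (x t) (x t') < e / 4" "dist (y t) (y t') < e / 4" using d x y t T(2) by blast+
      moreover have "dist (x t') (\<phi> x t') < e / 4" "dist (y t') (\<phi> x t') < e / 4"
        using \<phi> x y t' by metis+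
      ultimately show ?thesis by metric
    qed
    with y(3) show "\<exists>y\<in>Y. \<forall>t\<in>S. dist (x t) (y t) \<le> e" by blast
  qed
qed

lemma integral_add_const:
  fixes g :: "real \<Rightarrow> real"
  assumes "g integrable_on {s..t}" "s \<le> t"
  shows "integral {s..t} (\<lambda>x. g x + d) = integral {s..t} g + (t - s) * d"
  using assms Henstock_Kurzweil_Integration.integral_add[of g "{s..t}" "\<lambda>_. d"] by auto

section \<open>Estimates uniform over the ball of controls\<close>

context
  fixes f :: "real \<Rightarrow> 'x::euclidean_space \<Rightarrow> 'u::euclidean_space \<Rightarrow> 'x"
    and a b c p r :: real and x0 :: 'x
  assumes ab: "a \<le> b" and c: "0 < c" and p: "1 < p" and r: "0 < r"
    and growth: "\<And>t x u. t \<in> {a..b} \<Longrightarrow> norm (f t x u) \<le> c * (norm x + 1) * (norm u + 1)"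
begin

lemma Lp_ball_integrable_growth:
  assumes "u \<in> Lp_ball p r a b"
  shows "(\<lambda>s. c * (norm (u s) + 1)) integrable_on {a..b}"
  using Lp_ball_integrable_norm[OF assms] p
  by (intro integrable_on_mult_right integrable_add) auto

text \<open>In \<open>2 * (b - a) + r powr p\<close> one \<open>b - a\<close> comes from the L1
  bound with \<open>K = 1\<close> and the other from the \<open>+ 1\<close> beside
  \<open>norm u\<close> in the growth condition. The result does not depend on \<open>u\<close>, so
  all trajectories share one bounded region.\<close>

lemma trajectory_bound:
  assumes u: "u \<in> Lp_ball p r a b" and x: "trajectory f a b x0 u x" and t: "t \<in> {a..b}"
  shows "norm (x t) \<le> (norm x0 + 1) * exp (2 * (c * (2 * (b - a) + r powr p)))"
proof -
  have "norm (x t) + 1 \<le> (norm x0 + 1) * exp (2 * integral {a..b} (\<lambda>s. c * (norm (u s) + 1)))"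
  proof (rule linear_growth_bound[OF trajectory_continuous_on[OF x] Lp_ball_integrable_growth[OF u] _ _ _ t])
    fix s assume s: "s \<in> {a..b}"
    show "((\<lambda>\<xi>. f \<xi> (x \<xi>) (u \<xi>)) has_integral x s - x0) {a..s}"
      using trajectory_has_integral[OF x, of a s] s x by (simp add: trajectory_def)
    show "norm (f s (x s) (u s)) \<le> c * (norm (u s) + 1) * (norm (x s) + 1)"
      using growth[OF s, of "x s" "u s"] by (simp add: mult_ac)
  qed (use c in auto)
  also have "integral {a..b} (\<lambda>s. c * (norm (u s) + 1)) = c * (integral {a..b} (\<lambda>s. norm (u s)) + (b - a))"
    using Lp_ball_integrable_norm[OF u] p ab by (simp add: integral_add_const)
  also have "(norm x0 + 1) * exp (2 * (c * (integral {a..b} (\<lambda>s. norm (u s)) + (b - a))))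
      \<le> (norm x0 + 1) * exp (2 * (c * (2 * (b - a) + r powr p)))"
    using Lp_ball_integral_norm_bounded[OF u] p r ab c by (simp add: mult_left_mono)
  finally show ?thesis by simp
qed

lemma trajectories_equicontinuous:
  assumes "0 < e"
  obtains d where "0 < d" "\<And>x s t. x \<in> trajectories f a b x0 (Lp_ball p r a b) \<Longrightarrow> s \<in> {a..b} \<Longrightarrow> t \<in> {a..b} \<Longrightarrow>
    dist s t < d \<Longrightarrow> dist (x s) (x t) < e"
proof -
  define R where "R = (norm x0 + 1) * exp (2 * (c * (2 * (b - a) + r powr p)))"
  have "0 < R" by (simp add: R_def add_nonneg_pos)
  define k where "k = c * (R + 1)"
  have k: "0 < k" using c \<open>0 < R\<close> by (simp add: k_def)
  \<comment> \<open>Half of \<open>e\<close> absorbs the tail above the level \<open>K\<close>; then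
    \<open>d\<close> makes \<open>k * ((K + 1) * d)\<close> the other half, with the extra 1 due to
    the \<open>+ 1\<close> in the growth condition.\<close>
  obtain K where "0 < K" and K: "r powr p / K powr (p - 1) < e / (2 * k)"
    using ex_powr_divide_less[of "r powr p" "e / (2 * k)" p] p \<open>0 < e\<close> k by auto
  define d where "d = e / (2 * k * (K + 1))"
  have d: "0 < d" "k * ((K + 1) * d) = e / 2"
    using \<open>0 < e\<close> k \<open>0 < K\<close> by (auto simp: d_def)
  have main: "dist (x s) (x t) < e"
    if u: "u \<in> Lp_ball p r a b" and x: "trajectory f a b x0 u x" and st: "a \<le> s" "s \<le> t" "t \<le> b" and "t - s < d"
    for u x s t
  proof -
    have ui: "(\<lambda>\<xi>. norm (u \<xi>)) integrable_on {s..t}"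
      using st p by (intro integrable_subinterval_real[OF Lp_ball_integrable_norm[OF u]]) auto
    note hi = trajectory_has_integral[OF x st]
    have "dist (x s) (x t) = norm (integral {s..t} (\<lambda>\<xi>. f \<xi> (x \<xi>) (u \<xi>)))"
      using integral_unique[OF hi] by (simp add: dist_norm norm_minus_commute)
    also have "\<dots> \<le> integral {s..t} (\<lambda>\<xi>. k * (norm (u \<xi>) + 1))"
    proof (intro integral_norm_bound_integral has_integral_integrable[OF hi] integrable_on_mult_right integrable_add ui)
      fix \<xi> assume "\<xi> \<in> {s..t}"
      then have \<xi>: "\<xi> \<in> {a..b}" using st by auto
      have "norm (f \<xi> (x \<xi>) (u \<xi>)) \<le> c * (norm (x \<xi>) + 1) * (norm (u \<xi>) + 1)" by (rule growth[OF \<xi>])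
      also have "\<dots> \<le> k * (norm (u \<xi>) + 1)"
        using trajectory_bound[OF u x \<xi>] c unfolding k_def R_def by (intro mult_right_mono mult_left_mono) auto
      finally show "norm (f \<xi> (x \<xi>) (u \<xi>)) \<le> k * (norm (u \<xi>) + 1)" .
    qed auto
    also have "\<dots> = k * (integral {s..t} (\<lambda>\<xi>. norm (u \<xi>)) + (t - s))"
      using ui st by (simp add: integral_add_const)
    also have "\<dots> \<le> k * ((K * (t - s) + r powr p / K powr (p - 1)) + (t - s))"
      using Lp_ball_integral_norm_le[OF u _ _ \<open>0 < K\<close> st] p r k by (intro mult_left_mono) auto
    also have "\<dots> = k * ((K + 1) * (t - s)) + k * (r powr p / K powr (p - 1))"
      by (simp add: algebra_simps)
    also have "k * ((K + 1) * (t - s)) \<le> k * ((K + 1) * d)"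
      using k \<open>0 < K\<close> \<open>t - s < d\<close> by (intro mult_left_mono) auto
    also have "k * ((K + 1) * d) + k * (r powr p / K powr (p - 1)) < e / 2 + k * (e / (2 * k))"
      using K k d(2) by (intro add_le_less_mono mult_strict_left_mono) auto
    also have "\<dots> = e" using k by simp
    finally show ?thesis by simp
  qed
  show thesis
  proof (rule that[OF d(1)])
    fix x s t assume x: "x \<in> trajectories f a b x0 (Lp_ball p r a b)" and st: "s \<in> {a..b}" "t \<in> {a..b}" "dist s t < d"
    then obtain u where "u \<in> Lp_ball p r a b" "trajectory f a b x0 u x" by (auto simp: trajectories_def)
    then show "dist (x s) (x t) < e"
      using main[of u x s t] main[of u x t s] st by (cases "s \<le> t") (auto simp: dist_real_def dist_commute)
  qed
qed

lemma trajectories_finite_net: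
  assumes "0 < e"
  obtains Y where "finite Y" "Y \<subseteq> trajectories f a b x0 (Lp_ball p r a b)"
    "\<And>x. x \<in> trajectories f a b x0 (Lp_ball p r a b) \<Longrightarrow> \<exists>y\<in>Y. \<forall>t\<in>{a..b}. dist (x t) (y t) \<le> e"
proof (rule finite_net_equicontinuous[of "{a..b}" "trajectories f a b x0 (Lp_ball p r a b)"])
  show "norm (x t) \<le> (norm x0 + 1) * exp (2 * (c * (2 * (b - a) + r powr p)))"
    if "x \<in> trajectories f a b x0 (Lp_ball p r a b)" "t \<in> {a..b}" for x t
    using that trajectory_bound by (auto simp: trajectories_def)
  show "\<exists>d>0. \<forall>x\<in>trajectories f a b x0 (Lp_ball p r a b). \<forall>s\<in>{a..b}. \<forall>t\<in>{a..b}. dist s t < d \<longrightarrow> dist (x s) (x t) < e"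
    if "0 < e" for e
    using trajectories_equicontinuous[OF that] by metis
qed (use assms that in auto)

text \<open>The control enters the Lipschitz estimate additively through
  \<open>\<gamma>3 * norm (u1 - u2)\<close>, so Gronwall leaves only the L1 distance of the
  controls. The Gronwall kernel depends on both controls, but its integral is bounded over the ball,
  and hence the exponential factor is uniform.\<close>

lemma trajectory_control_stability:
  assumes u: "u \<in> Lp_ball p r a b" and x: "trajectory f a b x0 u x"
    and v: "v \<in> Lp_ball p r a b" and y: "trajectory f a b x0 v y"
    and \<gamma>: "0 < \<gamma>1" "0 < \<gamma>2" "0 < \<gamma>3"
    and lip: "\<And>t x1 x2 u1 u2. t \<in> {a..b} \<Longrightarrow>
      norm x1 \<le> (norm x0 + 1) * exp (2 * (c * (2 * (b - a) + r powr p))) \<Longrightarrow>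
      norm x2 \<le> (norm x0 + 1) * exp (2 * (c * (2 * (b - a) + r powr p))) \<Longrightarrow>
      norm (f t x1 u1 - f t x2 u2)
        \<le> (\<gamma>1 + \<gamma>2 * (norm u1 + norm u2)) * norm (x1 - x2) + \<gamma>3 * norm (u1 - u2)"
    and t: "t \<in> {a..b}"
  shows "norm (x t - y t) \<le> \<gamma>3 * integral {a..b} (\<lambda>s. norm (u s - v s))
      * exp (2 * (\<gamma>1 * (b - a) + 2 * \<gamma>2 * ((b - a) + r powr p)))"
proof -
  define k where "k s = \<gamma>1 + \<gamma>2 * (norm (u s) + norm (v s))" for s
  have uv: "(\<lambda>s. norm (u s)) integrable_on {a..b}" "(\<lambda>s. norm (v s)) integrable_on {a..b}"
    using Lp_ball_integrable_norm u v p by (metis less_imp_le)+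
  have k0: "0 \<le> k s" for s using \<gamma> by (simp add: k_def)
  have ki: "k integrable_on {a..b}"
    unfolding k_def by (intro integrable_add integrable_on_mult_right uv) auto
  have kw: "(\<lambda>s. k s * norm (x s - y s)) integrable_on {a..b}"
    by (intro integrable_mult_continuous ki k0 continuous_intros trajectory_continuous_on[OF x] trajectory_continuous_on[OF y])
  have "integrable (lebesgue_on {a..b}) u" "integrable (lebesgue_on {a..b}) v"
    using u v p by (auto intro!: Lp_space_integrable[of _ p] simp: Lp_ball_def)
  then have di: "(\<lambda>s. norm (u s - v s)) integrable_on {a..b}"
    by (intro integrable_on_lebesgue_on) auto
  define \<eta> where "\<eta> = \<gamma>3 * integral {a..b} (\<lambda>s. norm (u s - v s))"
  have \<eta>: "0 \<le> \<eta>" unfolding \<eta>_def using \<gamma> di by (simp add: integral_nonneg)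
  have "norm (x t - y t) \<le> \<eta> * exp (2 * integral {a..t} k)"
  proof (rule integral_Gronwall[OF ki kw k0 _ _ t])
    fix s assume s: "s \<in> {a..b}"
    note hx = trajectory_has_integral[OF x, of a s] and hy = trajectory_has_integral[OF y, of a s]
    have hi: "((\<lambda>\<xi>. f \<xi> (x \<xi>) (u \<xi>) - f \<xi> (y \<xi>) (v \<xi>)) has_integral x s - y s) {a..s}"
      using has_integral_diff[OF hx hy] s x y by (simp add: trajectory_def)
    have kwi: "(\<lambda>s. k s * norm (x s - y s)) integrable_on {a..s}" "(\<lambda>s. norm (u s - v s)) integrable_on {a..s}"
      using s by (auto intro: integrable_subinterval_real[OF kw] integrable_subinterval_real[OF di])
    have "norm (x s - y s) = norm (integral {a..s} (\<lambda>\<xi>. f \<xi> (x \<xi>) (u \<xi>) - f \<xi> (y \<xi>) (v \<xi>)))"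
      using integral_unique[OF hi] by simp
    also have "\<dots> \<le> integral {a..s} (\<lambda>\<xi>. k \<xi> * norm (x \<xi> - y \<xi>) + \<gamma>3 * norm (u \<xi> - v \<xi>))"
    proof (intro integral_norm_bound_integral has_integral_integrable[OF hi] integrable_add kwi integrable_on_mult_right)
      fix \<xi> assume "\<xi> \<in> {a..s}"
      then have \<xi>: "\<xi> \<in> {a..b}" using s by auto
      show "norm (f \<xi> (x \<xi>) (u \<xi>) - f \<xi> (y \<xi>) (v \<xi>)) \<le> k \<xi> * norm (x \<xi> - y \<xi>) + \<gamma>3 * norm (u \<xi> - v \<xi>)"
        unfolding k_def by (rule lip[OF \<xi> trajectory_bound[OF u x \<xi>] trajectory_bound[OF v y \<xi>]])
    qed
    also have "\<dots> = integral {a..s} (\<lambda>\<xi>. k \<xi> * norm (x \<xi> - y \<xi>)) + \<gamma>3 * integral {a..s} (\<lambda>\<xi>. norm (u \<xi> - v \<xi>))"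
      using kwi by (subst integral_add) (auto intro: integrable_on_mult_right)
    also have "\<gamma>3 * integral {a..s} (\<lambda>\<xi>. norm (u \<xi> - v \<xi>)) \<le> \<eta>"
      unfolding \<eta>_def using s \<gamma> di kwi by (intro mult_left_mono integral_subset_le) auto
    finally show "norm (x s - y s) \<le> \<eta> + integral {a..s} (\<lambda>\<xi>. k \<xi> * norm (x \<xi> - y \<xi>))" by simp
  qed auto
  also have "\<dots> \<le> \<eta> * exp (2 * (\<gamma>1 * (b - a) + 2 * \<gamma>2 * ((b - a) + r powr p)))"
  proof -
    have "integral {a..t} k \<le> integral {a..b} k"
      using t k0 ki by (intro integral_subset_le integrable_subinterval_real[OF ki]) auto
    also have "\<dots> = \<gamma>1 * (b - a) + \<gamma>2 * (integral {a..b} (\<lambda>s. norm (u s)) + integral {a..b} (\<lambda>s. norm (v s)))"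
    proof (rule integral_unique)
      show "(k has_integral \<gamma>1 * (b - a) + \<gamma>2 * (integral {a..b} (\<lambda>s. norm (u s)) + integral {a..b} (\<lambda>s. norm (v s)))) {a..b}"
        unfolding k_def
        using has_integral_const_real[of \<gamma>1 a b] ab
        by (intro has_integral_add has_integral_mult_right integrable_integral uv) (simp add: mult.commute)
    qed
    also have "\<dots> \<le> \<gamma>1 * (b - a) + \<gamma>2 * (((b - a) + r powr p) + ((b - a) + r powr p))"
      using Lp_ball_integral_norm_bounded[OF u] Lp_ball_integral_norm_bounded[OF v] p r ab \<gamma>
      by (intro add_left_mono mult_left_mono add_mono) auto
    also have "\<dots> = \<gamma>1 * (b - a) + 2 * \<gamma>2 * ((b - a) + r powr p)" by (simp add: algebra_simps)
    finally show ?thesis using \<eta> by (intro mult_left_mono) auto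
  qed
  finally show ?thesis by (simp add: \<eta>_def)
qed

end

section \<open>The Hausdorff distance\<close>

lemma mdist_C_space_le:
  assumes "trajectory f a b x0 u x" "trajectory f a b x0 v y" "a \<le> b"
    and "\<And>t. t \<in> {a..b} \<Longrightarrow> norm (x t - y t) \<le> e"
  shows "mdist (C_space a b) x y \<le> e"
  unfolding mdist_C_space[OF trajectory_in_C_space[OF assms(1)] trajectory_in_C_space[OF assms(2)] assms(3)]
  using assms(3,4) by (intro cSUP_least) auto

theorem theorem3p1:
  fixes f :: "real \<Rightarrow> real ^ 'n \<Rightarrow> real ^ 'm \<Rightarrow> real ^ 'n"
    and t0 \<theta> p r :: real and x0 :: "real ^ 'n"
  assumes "t0 < \<theta>" and "p > 1" and "r > 0"
    and A: "continuous_on ({t0..\<theta>} \<times> UNIV \<times> UNIV) (\<lambda>(t, x, u). f t x u)"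
    and B: "\<And>D. D \<subseteq> {t0..\<theta>} \<times> UNIV \<Longrightarrow> bounded D \<Longrightarrow>
      \<exists>\<gamma>1>0. \<exists>\<gamma>2>0. \<exists>\<gamma>3>0. \<forall>t x1 x2 u1 u2. (t, x1) \<in> D \<and> (t, x2) \<in> D \<longrightarrow>
        norm (f t x1 u1 - f t x2 u2)
          \<le> (\<gamma>1 + \<gamma>2 * (norm u1 + norm u2)) * norm (x1 - x2) + \<gamma>3 * norm (u1 - u2)"
    and C: "\<exists>c>0. \<forall>t\<in>{t0..\<theta>}. \<forall>x u. norm (f t x u) \<le> c * (norm x + 1) * (norm u + 1)"
  shows "\<forall>\<epsilon>>0. \<exists>\<beta>>0. \<exists>\<Delta>max>0. \<exists>\<delta>max>0. \<exists>\<sigma>max>0.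
    \<forall>\<Delta> N \<tau> \<delta> q \<rho> \<sigma> S.
      0 < \<Delta> \<and> \<Delta> \<le> \<Delta>max \<and> uniform_partition t0 \<theta> \<Delta> N \<tau> \<and>
      0 < \<delta> \<and> \<delta> \<le> \<delta>max \<and> uniform_partition 0 \<beta> \<delta> q \<rho> \<and>
      0 < \<sigma> \<and> \<sigma> \<le> \<sigma>max \<and> sphere_net \<sigma> S \<longrightarrow>
      hausdorff_mdist (C_space t0 \<theta>)
        (trajectories f t0 \<theta> x0 (Lp_ball p r t0 \<theta>))
        (trajectories f t0 \<theta> x0 (step_controls p r t0 \<theta> \<Delta> N \<tau> q \<rho> S))
      \<le> ennreal (\<epsilon> / 2)"
proof (intro allI impI)
  fix \<epsilon> :: real assume "0 < \<epsilon>"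
  have le: "t0 \<le> \<theta>" using \<open>t0 < \<theta>\<close> by simp
  obtain c where c: "0 < c" and growth: "\<And>t x u. t \<in> {t0..\<theta>} \<Longrightarrow> norm (f t x u) \<le> c * (norm x + 1) * (norm u + 1)"
    using C by blast
  \<comment> \<open>This bounds every admissible trajectory, so one application of \<open>B\<close>
    yields constants independent of the controls.\<close>
  define R where "R = (norm x0 + 1) * exp (2 * (c * (2 * (\<theta> - t0) + r powr p)))"
  have D: "bounded ({t0..\<theta>} \<times> cball (0::real^'n) R)" "{t0..\<theta>} \<times> cball (0::real^'n) R \<subseteq> {t0..\<theta>} \<times> UNIV"
    by (auto intro: bounded_Times)
  from B[OF D(2,1)] obtain \<gamma>1 \<gamma>2 \<gamma>3 where \<gamma>: "0 < \<gamma>1" "0 < \<gamma>2" "0 < \<gamma>3" and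
    lipD: "\<And>t x1 x2 u1 u2. (t, x1) \<in> {t0..\<theta>} \<times> cball 0 R \<Longrightarrow> (t, x2) \<in> {t0..\<theta>} \<times> cball 0 R \<Longrightarrow>
      norm (f t x1 u1 - f t x2 u2) \<le> (\<gamma>1 + \<gamma>2 * (norm u1 + norm u2)) * norm (x1 - x2) + \<gamma>3 * norm (u1 - u2)"
    by blast
  have lip: "norm (f t x1 u1 - f t x2 u2) \<le> (\<gamma>1 + \<gamma>2 * (norm u1 + norm u2)) * norm (x1 - x2) + \<gamma>3 * norm (u1 - u2)"
    if "t \<in> {t0..\<theta>}" "norm x1 \<le> R" "norm x2 \<le> R" for t x1 x2 u1 u2
    using that by (intro lipD) auto
  define E where "E = exp (2 * (\<gamma>1 * (\<theta> - t0) + 2 * \<gamma>2 * ((\<theta> - t0) + r powr p)))"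
  \<comment> \<open>The L1 distance of controls that moves trajectories by at most
    \<open>\<epsilon> / 4\<close>, as \<open>E\<close> is the exponential factor of the stability
    estimate. It is split into three thirds: averaging, rounding and capping.\<close>
  define \<eta> where "\<eta> = \<epsilon> / (4 * \<gamma>3 * E)"
  have \<eta>: "0 < \<eta>" "\<gamma>3 * \<eta> * E = \<epsilon> / 4" using \<open>0 < \<epsilon>\<close> \<gamma> by (auto simp: \<eta>_def E_def)
  obtain \<beta> where "0 < \<beta>" and \<beta>: "r powr p / \<beta> powr (p - 1) < \<eta> / 3"
    using ex_powr_divide_less[of "r powr p" "\<eta> / 3" p] \<open>p > 1\<close> \<eta> by auto
  \<comment> \<open>Radial and directional rounding get equal halves of the third
    \<open>\<eta> / 3\<close>; the directional error is \<open>\<beta> * \<sigma>\<close>, whence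
    the division by the already fixed \<open>\<beta>\<close> in \<open>\<sigma>m\<close>.\<close>
  define \<delta>m where "\<delta>m = \<eta> / (6 * (\<theta> - t0))"
  define \<sigma>m where "\<sigma>m = \<delta>m / \<beta>"
  have \<delta>m: "0 < \<delta>m" "(\<theta> - t0) * (\<delta>m + \<delta>m) = \<eta> / 3" and \<sigma>m: "0 < \<sigma>m" "\<beta> * \<sigma>m = \<delta>m"
  proof -
    have "T * (\<eta> / (6 * T) + \<eta> / (6 * T)) = \<eta> / 3" if "0 < T" for T using that by simp
    from this[of "\<theta> - t0"] show "(\<theta> - t0) * (\<delta>m + \<delta>m) = \<eta> / 3" using \<open>t0 < \<theta>\<close> unfolding \<delta>m_def by simp
  qed (use \<open>t0 < \<theta>\<close> \<open>0 < \<beta>\<close> \<eta> in \<open>auto simp: \<delta>m_def \<sigma>m_def\<close>)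
  let ?X = "trajectories f t0 \<theta> x0 (Lp_ball p r t0 \<theta>)"
  obtain Y where Y: "finite Y" "Y \<subseteq> ?X" and net: "\<And>x. x \<in> ?X \<Longrightarrow> \<exists>y\<in>Y. \<forall>t\<in>{t0..\<theta>}. dist (x t) (y t) \<le> \<epsilon> / 4"
    by (rule trajectories_finite_net[OF le c \<open>p > 1\<close> \<open>r > 0\<close> growth, where e = "\<epsilon> / 4"]) (use \<open>0 < \<epsilon>\<close> in auto)
  have "\<forall>y\<in>Y. \<exists>u. u \<in> Lp_ball p r t0 \<theta> \<and> trajectory f t0 \<theta> x0 u y"
    using Y(2) by (auto simp: trajectories_def)
  then obtain U where U: "\<And>y. y \<in> Y \<Longrightarrow> U y \<in> Lp_ball p r t0 \<theta>" "\<And>y. y \<in> Y \<Longrightarrow> trajectory f t0 \<theta> x0 (U y) y"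
    by metis
  define avg where "avg u d N \<tau> = (\<Sum>i<N. integral {\<tau> i..\<tau> (Suc i)} (\<lambda>s. norm (u s - (1 / d) *\<^sub>R integral {\<tau> i..\<tau> (Suc i)} u)))"
    for u :: "real \<Rightarrow> real^'m" and d :: real and N :: nat and \<tau> :: "nat \<Rightarrow> real"
  have "\<forall>y\<in>Y. \<exists>d>0. \<forall>\<Delta> N \<tau>. 0 < \<Delta> \<longrightarrow> \<Delta> \<le> d \<longrightarrow> uniform_partition t0 \<theta> \<Delta> N \<tau> \<longrightarrow> avg (U y) \<Delta> N \<tau> \<le> \<eta> / 3"
  proof
    fix y assume "y \<in> Y"
    then have "integrable (lebesgue_on {t0..\<theta>}) (U y)"
      using U(1) \<open>p > 1\<close> by (intro Lp_space_integrable[of _ p]) (auto simp: Lp_ball_def)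
    then show "\<exists>d>0. \<forall>\<Delta> N \<tau>. 0 < \<Delta> \<longrightarrow> \<Delta> \<le> d \<longrightarrow> uniform_partition t0 \<theta> \<Delta> N \<tau> \<longrightarrow> avg (U y) \<Delta> N \<tau> \<le> \<eta> / 3"
      using \<eta> unfolding avg_def by (rule_tac step_average_L1_convergence[OF _ \<open>t0 < \<theta>\<close>, of "U y" "\<eta> / 3"]) auto
  qed
  then obtain d where d: "\<And>y. y \<in> Y \<Longrightarrow> 0 < d y"
    "\<And>y \<Delta> N \<tau>. y \<in> Y \<Longrightarrow> 0 < \<Delta> \<Longrightarrow> \<Delta> \<le> d y \<Longrightarrow> uniform_partition t0 \<theta> \<Delta> N \<tau> \<Longrightarrow> avg (U y) \<Delta> N \<tau> \<le> \<eta> / 3"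
    by metis
  \<comment> \<open>The added 1 makes the minimum meaningful for empty \<open>Y\<close> as
    well.\<close>
  define \<Delta>m where "\<Delta>m = Min (insert 1 (d ` Y))"
  have \<Delta>m: "0 < \<Delta>m" "\<And>y. y \<in> Y \<Longrightarrow> \<Delta>m \<le> d y"
    using Y(1) d(1) by (auto simp: \<Delta>m_def)
  have "hausdorff_mdist (C_space t0 \<theta>) ?X (trajectories f t0 \<theta> x0 (step_controls p r t0 \<theta> \<Delta> N \<tau> q \<rho> S)) \<le> ennreal (\<epsilon> / 2)"
    if h: "0 < \<Delta>" "\<Delta> \<le> \<Delta>m" and P: "uniform_partition t0 \<theta> \<Delta> N \<tau>"
      and h': "0 < \<delta>" "\<delta> \<le> \<delta>m" and Q: "uniform_partition 0 \<beta> \<delta> q \<rho>"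
      and h'': "0 < \<sigma>" "\<sigma> \<le> \<sigma>m" and S: "sphere_net \<sigma> S" for \<Delta> N \<tau> \<delta> q \<rho> \<sigma> S
  proof -
    let ?V = "step_controls p r t0 \<theta> \<Delta> N \<tau> q \<rho> S"
    have VU: "?V \<subseteq> Lp_ball p r t0 \<theta>"
      using S by (intro step_controls_subset_Lp_ball[OF P h(1) Q h'(1) _ \<open>p > 1\<close> \<open>r > 0\<close>]) (auto simp: sphere_net_def)
    have 1: "\<exists>z\<in>trajectories f t0 \<theta> x0 ?V. mdist (C_space t0 \<theta>) x z \<le> \<epsilon> / 2" if x: "x \<in> ?X" for x
    proof -
      obtain y where y: "y \<in> Y" "\<And>t. t \<in> {t0..\<theta>} \<Longrightarrow> dist (x t) (y t) \<le> \<epsilon> / 4" using net[OF x] by blast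
      obtain v where v: "v \<in> ?V" and uv: "integral {t0..\<theta>} (\<lambda>s. norm (U y s - v s)) \<le>
          avg (U y) \<Delta> N \<tau> + (\<theta> - t0) * (\<delta> + \<beta> * \<sigma>) + r powr p / \<beta> powr (p - 1)"
        unfolding avg_def
        using step_control_approximation[OF U(1)[OF y(1)] \<open>p > 1\<close> \<open>r > 0\<close> P h(1) Q h'(1) \<open>0 < \<beta>\<close> S] h''(1) by auto
      have "\<beta> * \<sigma> \<le> \<delta>m" using h''(2) \<open>0 < \<beta>\<close> \<sigma>m(2) by (metis less_imp_le mult_left_mono)
      then have "(\<theta> - t0) * (\<delta> + \<beta> * \<sigma>) \<le> \<eta> / 3"
        unfolding \<delta>m(2)[symmetric] using h'(2) le by (intro mult_left_mono) auto
      moreover have "avg (U y) \<Delta> N \<tau> \<le> \<eta> / 3"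
        using h \<Delta>m(2)[OF y(1)] by (intro d(2)[OF y(1)] P) auto
      ultimately have uv: "integral {t0..\<theta>} (\<lambda>s. norm (U y s - v s)) \<le> \<eta>" using uv \<beta> by linarith
      have vm: "v \<in> borel_measurable (lebesgue_on {t0..\<theta>})" using v by (simp add: step_controls_def Lp_space_def)
      obtain z where z: "trajectory f t0 \<theta> x0 v z"
        using trajectory_exists[OF le A B c growth vm step_controls_bounded[OF v P h(1)] _ step_controls_continuous[OF v P h(1)]]
        by blast
      have yz: "norm (y t - z t) \<le> \<epsilon> / 4" if t: "t \<in> {t0..\<theta>}" for t
      proof -
        have "norm (y t - z t) \<le> \<gamma>3 * integral {t0..\<theta>} (\<lambda>s. norm (U y s - v s)) * E"
          unfolding E_def
          using trajectory_control_stability[OF le c \<open>p > 1\<close> \<open>r > 0\<close> growth U(1)[OF y(1)] U(2)[OF y(1)] subsetD[OF VU v] z \<gamma>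
              lip[unfolded R_def] t] .
        also have "\<dots> \<le> \<gamma>3 * \<eta> * E"
          using uv \<gamma> by (intro mult_right_mono mult_left_mono) (auto simp: E_def)
        finally show ?thesis using \<eta> by simp
      qed
      obtain u where u: "trajectory f t0 \<theta> x0 u x" using x by (auto simp: trajectories_def)
      \<comment> \<open>One \<open>\<epsilon> / 4\<close> from \<open>x\<close> to the net element
        \<open>y\<close>, another from \<open>y\<close> to the trajectory \<open>z\<close> of the
        step control approximating the control of \<open>y\<close>.\<close>
      have "mdist (C_space t0 \<theta>) x z \<le> \<epsilon> / 2"
      proof (rule mdist_C_space_le[OF u z le])
        fix t assume t: "t \<in> {t0..\<theta>}"
        show "norm (x t - z t) \<le> \<epsilon> / 2"
          using y(2)[OF t] yz[OF t] norm_triangle_ineq[of "x t - y t" "y t - z t"] by (simp add: dist_norm)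
      qed
      then show ?thesis using v z by (auto simp: trajectories_def)
    qed
    have 2: "z \<in> ?X" if "z \<in> trajectories f t0 \<theta> x0 ?V" for z
      using that VU by (auto simp: trajectories_def)
    show ?thesis
      unfolding hausdorff_mdist_def
    proof (intro max.boundedI SUP_least)
      fix x assume "x \<in> ?X"
      then obtain z where z: "z \<in> trajectories f t0 \<theta> x0 ?V" "mdist (C_space t0 \<theta>) x z \<le> \<epsilon> / 2" using 1 by blast
      show "(INF z\<in>trajectories f t0 \<theta> x0 ?V. ennreal (mdist (C_space t0 \<theta>) x z)) \<le> ennreal (\<epsilon> / 2)"
        by (rule INF_lower2[OF z(1)]) (rule ennreal_leI[OF z(2)])
    next
      \<comment> \<open>Here \<open>z\<close> serves as its own approximation, since step controls
        lie in the ball.\<close>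
      fix z assume z: "z \<in> trajectories f t0 \<theta> x0 ?V"
      then obtain v where v: "trajectory f t0 \<theta> x0 v z" by (auto simp: trajectories_def)
      show "(INF x\<in>?X. ennreal (mdist (C_space t0 \<theta>) x z)) \<le> ennreal (\<epsilon> / 2)"
        using \<open>0 < \<epsilon>\<close> by (intro INF_lower2[OF 2[OF z]] ennreal_leI mdist_C_space_le[OF v v le]) auto
    qed
  qed
  with \<open>0 < \<beta>\<close> \<Delta>m(1) \<delta>m(1) \<sigma>m(1)
  show "\<exists>\<beta>>0. \<exists>\<Delta>max>0. \<exists>\<delta>max>0. \<exists>\<sigma>max>0. \<forall>\<Delta> N \<tau> \<delta> q \<rho> \<sigma> S.
      0 < \<Delta> \<and> \<Delta> \<le> \<Delta>max \<and> uniform_partition t0 \<theta> \<Delta> N \<tau> \<and>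
      0 < \<delta> \<and> \<delta> \<le> \<delta>max \<and> uniform_partition 0 \<beta> \<delta> q \<rho> \<and>
      0 < \<sigma> \<and> \<sigma> \<le> \<sigma>max \<and> sphere_net \<sigma> S \<longrightarrow>
      hausdorff_mdist (C_space t0 \<theta>) ?X (trajectories f t0 \<theta> x0 (step_controls p r t0 \<theta> \<Delta> N \<tau> q \<rho> S)) \<le> ennreal (\<epsilon> / 2)"
    by (intro exI[of _ \<beta>] exI[of _ \<Delta>m] exI[of _ \<delta>m] exI[of _ \<sigma>m] conjI allI impI) auto
qed

end
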